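(* Let $p\ge 2$ be an integer, let $f:\mathbb{E}\to\mathbb{R}$ be convex and $p$-times differentiable with a global minimizer $x^*$, and let $\nu\in[0,1]$ be such that $H_{f,p}(\nu)<+\infty$. Let $x_0\in\mathbb{E}$ and suppose there is $D_0\in(1,+\infty)$ with $\max_{x\in\mathcal{L}(x_0)}\|x-x^*\|\le D_0$, where $\mathcal{L}(x_0)=\{x\in\mathbb{E}: f(x)\le f(x_0)\}$. Let $\alpha=\nu$ (case "$\nu$ known") or $\alpha=1$ (case "$\nu$ unknown"). Given $\epsilon\in(0,1)$, assume that $\{x_t\}_{t=0}^T$ is a sequence generated by the Adaptive Accelerated Tensor Method (Algorithm 4, described in the context) with parameters $\alpha$, $H_0>0$, $\theta\ge0$, such that $$f(x_0)-f(x^* )\ge\epsilon\quad\text{and}\quad f(x_{t,i}^+)-f(x^* )\ge\epsilon,\qquad i=0,\ldots,i_t,\ t=0,\ldots,T.$$ Then, for $2\le t\le T$, $$f(x_t)-f(x^* )\le\frac{2^{3p}\max\{\tilde N_\nu(\epsilon),H_0\}(p+\alpha)^{p+\alpha-1}\|x_0-x^*\|^{p+\alpha}}{(p-1)!\,(t-1)^{p+\alpha}}.$$ Consequently, if $\nu$ is known (i.e. $\alpha=\nu$), $$T\le1+\left[\frac{2^{3p}\max\{H_0,(p+\nu-1)(H_{f,p}(\nu)+\theta(p-1)!)\}(p+\nu)^{p+\nu-1}\|x_0-x^*\|^{p+\nu}}{(p-1)!}\right]^{\frac1{p+\nu}}\left(\frac1\epsilon\right)^{\frac1{p+\nu}},$$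 and if $\nu$ is unknown (i.e. $\alpha=1$), $$T\le1+\left[\frac{2^{3p}\max\left\{H_0,4\theta(p-1)!,(4H_{f,p}(\nu))^{\frac p{p+\nu-1}}(4D_0)^{\frac{1-\nu}{p+\nu-1}}\right\}(p+1)^p\|x_0-x^*\|^{p+1}}{(p-1)!}\right]^{\frac1{p+1}}\left(\frac1\epsilon\right)^{\frac p{(p+1)(p+\nu-1)}}.$$
   Context: $\mathbb{E}$ is a finite-dimensional real vector space with dual $\mathbb{E}^*$; $B:\mathbb{E}\to\mathbb{E}^*$ is a self-adjoint positive definite operator, $\|x\|=\langle Bx,x\rangle^{1/2}$ on $\mathbb{E}$ and $\|s\|_*=\langle s,B^{-1}s\rangle^{1/2}$ on $\mathbb{E}^*$. For symmetric $p$-linear forms the norm is $\|D^pf(x)-D^pf(y)\|=\max_{\|h\|\le1}|D^pf(x)[h]^p-D^pf(y)[h]^p|$. The Hölder constant is $$H_{f,p}(\nu)=\sup_{x\ne y}\frac{\|D^pf(x)-D^pf(y)\|}{\|x-y\|^\nu},\qquad 0\le\nu\le1.$$ $\Phi_{x,p}(y)=f(x)+\sum_{i=1}^p\frac1{i!}D^if(x)[y-x]^i$, and $\Omega^{(\alpha)}_{x,p,H}(y)=\Phi_{x,p}(y)+\frac{H}{p!}\|y-x\|^{p+\alpha}$ for $H>0$, $\alpha\in[0,1]$. Adaptive Accelerated Tensor Method (Algorithm 4). Given $x_0\in\mathbb{E}$, $H_0>0$, $\theta\ge0$ and $\alpha$, set $\psi_0(x)=\frac1{p+\alpha}\|x-x_0\|^{p+\alpha}$,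 $v_0=x_0$, $A_0=0$. At iteration $t\ge0$, for $i=0,1,2,\ldots$ successively: let $a_{t,i}>0$ solve $$a_{t,i}^{p+\alpha}=\frac1{2^{3p-1}}\left[\frac{(p-1)!}{2^iH_t}\right](A_t+a_{t,i})^{p+\alpha-1},$$ set $\gamma_{t,i}=\frac{a_{t,i}}{A_t+a_{t,i}}$, $y_{t,i}=(1-\gamma_{t,i})x_t+\gamma_{t,i}v_t$, and compute a point $x_{t,i}^+$ such that $$\Omega^{(\alpha)}_{y_{t,i},p,2^iH_t}(x_{t,i}^+)\le f(y_{t,i}),\qquad\|\nabla\Omega^{(\alpha)}_{y_{t,i},p,2^iH_t}(x_{t,i}^+)\|_*\le\theta\|x_{t,i}^+-y_{t,i}\|^{p+\alpha-1}.$$ Let $i_t$ be the first $i$ for which $$\langle\nabla f(x_{t,i}^+),y_{t,i}-x_{t,i}^+\rangle\ge\frac14\left[\frac{(p-1)!}{2^iH_t}\right]^{\frac1{p+\alpha-1}}\|\nabla f(x_{t,i}^+)\|_*^{\frac{p+\alpha}{p+\alpha-1}}.$$ Then set $x_{t+1}=x_{t,i_t}^+$, $a_t=a_{t,i_t}$, $A_{t+1}=A_t+a_t$, $H_{t+1}=2^{i_t-1}H_t$, $\psi_{t+1}(x)=\psi_t(x)+a_t[f(x_{t+1})+\langle\nabla f(x_{t+1}),x-x_{t+1}\rangle]$ and $v_{t+1}=\arg\min_{x\in\mathbb{E}}\psi_{t+1}(x)$. The function $\tilde N_\nu(\epsilon)$ is: if $\alpha=\nu$ ($\nu$ known), $\tilde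 N_\nu(\epsilon)=(p+\nu-1)(H_{f,p}(\nu)+\theta(p-1)!)$; if $\alpha=1$ ($\nu$ unknown), $$\tilde N_\nu(\epsilon)=\max\left\{4\theta(p-1)!,(4H_{f,p}(\nu))^{\frac p{p+\nu-1}}\left(\tfrac{4R(\epsilon)}{\epsilon}\right)^{\frac{1-\nu}{p+\nu-1}}\right\},$$ where $R(\epsilon)=\max\{\|x-x^*\|: x\in\mathbb{E},\ f(x)\le f(x^* )+\epsilon\}$. *)

theory Defs
  imports "HOL-Analysis.Analysis"
begin

(* The space E is a type 'a of class euclidean_space. Its built-in inner product only serves to
   provide the topology; all metric notions come from the operator B : E -> E*, where
   the dual E* is the type of bounded linear functionals and <s,x> is blinfun_apply s x. *)

definition self_adjoint_pos_def :: "('a::euclidean_space \<Rightarrow> ('a \<Rightarrow>\<^sub>L real)) \<Rightarrow> bool" where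
  "self_adjoint_pos_def B \<longleftrightarrow>
     linear B \<and>
     (\<forall>x y. blinfun_apply (B x) y = blinfun_apply (B y) x) \<and>
     (\<forall>x. x \<noteq> 0 \<longrightarrow> blinfun_apply (B x) x > 0)"

definition primal_norm :: "('a::euclidean_space \<Rightarrow> ('a \<Rightarrow>\<^sub>L real)) \<Rightarrow> 'a \<Rightarrow> real" where
  "primal_norm B x = sqrt (blinfun_apply (B x) x)"

definition dual_norm :: "('a::euclidean_space \<Rightarrow> ('a \<Rightarrow>\<^sub>L real)) \<Rightarrow> ('a \<Rightarrow>\<^sub>L real) \<Rightarrow> real" where
  "dual_norm B s = sqrt (blinfun_apply s (inv B s))"

definition gradient :: "('a::euclidean_space \<Rightarrow> real) \<Rightarrow> 'a \<Rightarrow> ('a \<Rightarrow>\<^sub>L real)" where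
  "gradient f x = Blinfun (frechet_derivative f (at x))"

(* higher_deriv f [h1, ..., hi] x is the value D^i f(x)[h1, ..., hi] of the i-th derivative. *)
fun higher_deriv :: "('a::euclidean_space \<Rightarrow> real) \<Rightarrow> 'a list \<Rightarrow> 'a \<Rightarrow> real" where
  "higher_deriv f [] = f"
| "higher_deriv f (h # hs) = (\<lambda>x. frechet_derivative (higher_deriv f hs) (at x) h)"

(* In finite dimension the form-valued map D^i f is (Frechet) differentiable if and only if
   x |-> D^i f(x)[h1, ..., hi] is differentiable for all directions h1, ..., hi. *)
definition times_differentiable :: "nat \<Rightarrow> ('a::euclidean_space \<Rightarrow> real) \<Rightarrow> bool" where
  "times_differentiable p f \<longleftrightarrow>
     (\<forall>hs x. length hs < p \<longrightarrow> higher_deriv f hs differentiable (at x))"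

(* A p-linear form is a function on lists of length p; the supremum is attained,
   because the unit ball is compact. *)
definition form_norm ::
  "('a::euclidean_space \<Rightarrow> ('a \<Rightarrow>\<^sub>L real)) \<Rightarrow> nat \<Rightarrow> ('a list \<Rightarrow> real) \<Rightarrow> real" where
  "form_norm B p F = (SUP h\<in>{h. primal_norm B h \<le> 1}. \<bar>F (replicate p h)\<bar>)"

definition holder_const ::
  "('a::euclidean_space \<Rightarrow> ('a \<Rightarrow>\<^sub>L real)) \<Rightarrow> ('a \<Rightarrow> real) \<Rightarrow> nat \<Rightarrow> real \<Rightarrow> ereal" where
  "holder_const B f p \<nu> =
     (SUP (x, y)\<in>{(x, y). x \<noteq> y}.
        ereal (form_norm B p (\<lambda>hs. higher_deriv f hs x - higher_deriv f hs y)
               / primal_norm B (x - y) powr \<nu>))"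

definition taylor_model :: "('a::euclidean_space \<Rightarrow> real) \<Rightarrow> nat \<Rightarrow> 'a \<Rightarrow> 'a \<Rightarrow> real" where
  "taylor_model f p x y =
     f x + (\<Sum>i=1..p. 1 / fact i * higher_deriv f (replicate i (y - x)) x)"

(* Omega^(alpha)_{x,p,M}(y), with M the regularisation parameter. *)
definition reg_model ::
  "('a::euclidean_space \<Rightarrow> ('a \<Rightarrow>\<^sub>L real)) \<Rightarrow> ('a \<Rightarrow> real) \<Rightarrow> nat \<Rightarrow> real \<Rightarrow> real \<Rightarrow> 'a \<Rightarrow> 'a \<Rightarrow> real"
  where
  "reg_model B f p \<alpha> M x y =
     taylor_model f p x y + M / fact p * primal_norm B (y - x) powr (real p + \<alpha>)"

definition inexact_step ::
  "('a::euclidean_space \<Rightarrow> ('a \<Rightarrow>\<^sub>L real)) \<Rightarrow> ('a \<Rightarrow> real) \<Rightarrow> nat \<Rightarrow> real \<Rightarrow> real \<Rightarrow> real \<Rightarrow> 'a \<Rightarrow> 'a \<Rightarrow> bool"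
  where
  "inexact_step B f p \<alpha> \<theta> M y z \<longleftrightarrow>
     reg_model B f p \<alpha> M y z \<le> f y \<and>
     dual_norm B (gradient (reg_model B f p \<alpha> M y) z)
       \<le> \<theta> * primal_norm B (z - y) powr (real p + \<alpha> - 1)"

definition accepted ::
  "('a::euclidean_space \<Rightarrow> ('a \<Rightarrow>\<^sub>L real)) \<Rightarrow> ('a \<Rightarrow> real) \<Rightarrow> nat \<Rightarrow> real \<Rightarrow> real \<Rightarrow> 'a \<Rightarrow> 'a \<Rightarrow> bool"
  where
  "accepted B f p \<alpha> M y z \<longleftrightarrow>
     blinfun_apply (gradient f z) (y - z)
       \<ge> 1 / 4 * (fact (p - 1) / M) powr (1 / (real p + \<alpha> - 1))
           * dual_norm B (gradient f z) powr ((real p + \<alpha>) / (real p + \<alpha> - 1))"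

(* The iterations t = 0, ..., T of the Adaptive Accelerated Tensor Method. The trial quantities
   aa t i, g t i, y t i, xp t i (a, gamma, y, x^+ in the t-th iteration) are
   constrained only for i = 0, ..., it t, where it t is the first index that is accepted;
   the values of all sequences outside the computed range are irrelevant. *)
definition AATM_run ::
  "('a::euclidean_space \<Rightarrow> ('a \<Rightarrow>\<^sub>L real)) \<Rightarrow> ('a \<Rightarrow> real) \<Rightarrow> nat \<Rightarrow> real \<Rightarrow> real \<Rightarrow> 'a \<Rightarrow> real \<Rightarrow> nat \<Rightarrow>
   (nat \<Rightarrow> 'a) \<Rightarrow> (nat \<Rightarrow> 'a) \<Rightarrow> (nat \<Rightarrow> real) \<Rightarrow> (nat \<Rightarrow> real) \<Rightarrow> (nat \<Rightarrow> 'a \<Rightarrow> real) \<Rightarrow>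
   (nat \<Rightarrow> nat) \<Rightarrow> (nat \<Rightarrow> nat \<Rightarrow> real) \<Rightarrow> (nat \<Rightarrow> nat \<Rightarrow> real) \<Rightarrow> (nat \<Rightarrow> nat \<Rightarrow> 'a) \<Rightarrow> (nat \<Rightarrow> nat \<Rightarrow> 'a) \<Rightarrow> bool"
  where
  "AATM_run B f p \<alpha> \<theta> x0 H0 T x v A H \<psi> it aa g y xp \<longleftrightarrow>
     x 0 = x0 \<and> v 0 = x0 \<and> A 0 = 0 \<and> H 0 = H0 \<and>
     \<psi> 0 = (\<lambda>z. 1 / (real p + \<alpha>) * primal_norm B (z - x0) powr (real p + \<alpha>)) \<and>
     (\<forall>t\<le>T.
        (\<forall>i\<le>it t.
           aa t i > 0 \<and>
           aa t i powr (real p + \<alpha>)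
             = 1 / 2 ^ (3 * p - 1) * (fact (p - 1) / (2 ^ i * H t))
                 * (A t + aa t i) powr (real p + \<alpha> - 1) \<and>
           g t i = aa t i / (A t + aa t i) \<and>
           y t i = (1 - g t i) *\<^sub>R x t + g t i *\<^sub>R v t \<and>
           inexact_step B f p \<alpha> \<theta> (2 ^ i * H t) (y t i) (xp t i)) \<and>
        (\<forall>i<it t. \<not> accepted B f p \<alpha> (2 ^ i * H t) (y t i) (xp t i)) \<and>
        accepted B f p \<alpha> (2 ^ it t * H t) (y t (it t)) (xp t (it t)) \<and>
        x (Suc t) = xp t (it t) \<and>
        A (Suc t) = A t + aa t (it t) \<and>
        H (Suc t) = 2 powi (int (it t) - 1) * H t \<and>
        \<psi> (Suc t) = (\<lambda>z. \<psi> t z + aa t (it t) *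
           (f (x (Suc t)) + blinfun_apply (gradient f (x (Suc t))) (z - x (Suc t)))) \<and>
        is_arg_min (\<psi> (Suc t)) (\<lambda>_. True) (v (Suc t)))"

definition level_radius ::
  "('a::euclidean_space \<Rightarrow> ('a \<Rightarrow>\<^sub>L real)) \<Rightarrow> ('a \<Rightarrow> real) \<Rightarrow> 'a \<Rightarrow> real \<Rightarrow> real" where
  "level_radius B f xs \<epsilon> = (SUP x\<in>{x. f x \<le> f xs + \<epsilon>}. primal_norm B (x - xs))"

(* The flag known tells whether the method uses alpha = nu or alpha = 1. For nu = 1 both
   give alpha = 1, so alpha alone does not determine which formula is meant. *)
definition N_tilde ::
  "('a::euclidean_space \<Rightarrow> ('a \<Rightarrow>\<^sub>L real)) \<Rightarrow> ('a \<Rightarrow> real) \<Rightarrow> nat \<Rightarrow> real \<Rightarrow> 'a \<Rightarrow> bool \<Rightarrow> real \<Rightarrow> real \<Rightarrow> real"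
  where
  "N_tilde B f p \<theta> xs known \<nu> \<epsilon> =
     (let Hf = real_of_ereal (holder_const B f p \<nu>) in
      if known then (real p + \<nu> - 1) * (Hf + \<theta> * fact (p - 1))
      else max (4 * \<theta> * fact (p - 1))
             ((4 * Hf) powr (real p / (real p + \<nu> - 1))
              * (4 * level_radius B f xs \<epsilon> / \<epsilon>) powr ((1 - \<nu>) / (real p + \<nu> - 1))))"

end

(* Banach's theorem on symmetric multilinear forms bounds the p-th derivative in mixed directions by
   the diagonal norm, so a Taylor expansion controls the distance between the gradients of f and of
   its Taylor model at a trial point. If the regularisation parameter is large enough, the gradient
   at the trial point is then close to a multiple of y - x and the acceptance test succeeds; when nu
   is unknown this needs a lower bound eps / R(eps) for the gradient, which convexity supplies.
   Hence H_t never exceeds max {N, H_0}. Uniform convexity of |.|^q, in Clarkson's midpoint form,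
   keeps A_t f(x_t) below the minimum of psi_t, and the recursion for a_t makes A_t grow like t^q. *)
theory Submission
  imports Defs
begin

section \<open>Norms induced by the operator\<close>

text \<open>Polarization bounds mixed derivatives only up to a factor depending on p, while
  \<open>N_tilde\<close> contains the Hoelder constant without such a factor; hence the sharp form
  of Banach's theorem. For \<nu> = 0 the p-th derivative need not be continuous, so symmetry comes
  from difference quotients and the Taylor remainder from the mean value theorem. Put q = p +
  \<alpha> and r = |z - y|. The acceptance test tolerates a gradient error of \<eta> M / (p-1)!
  r^(q-1) as long as \<eta>^2 <= (3 + 1/(q-1)) / 4. For known \<nu> the threshold on M gives \<eta>
  = 1/(q-1); for unknown \<nu> it gives \<eta> = 1/2, a quarter each for the Hoelder error and for
  \<theta>. The constant 2^(3p-1) in the equation for a_t lets the progress coefficient 1/4 of the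
  test pay, after Young's inequality, for a linear term that the convexity modulus 2^(1-q)/q does
  not absorb. It becomes 2^(3p) in the rate because the accepted trial parameter equals 2
  H_(t+1).\<close>

locale spd_operator =
  fixes B :: "'a::euclidean_space \<Rightarrow> ('a \<Rightarrow>\<^sub>L real)"
  assumes spd: "self_adjoint_pos_def B"
begin

abbreviation pn :: "'a \<Rightarrow> real" where "pn \<equiv> primal_norm B"
abbreviation dn :: "('a \<Rightarrow>\<^sub>L real) \<Rightarrow> real" where "dn \<equiv> dual_norm B"
abbreviation ip :: "'a \<Rightarrow> 'a \<Rightarrow> real" where "ip x y \<equiv> blinfun_apply (B x) y"

lemma linear_B: "linear B"
  using spd by (simp add: self_adjoint_pos_def_def)

lemma ip_commute: "ip x y = ip y x"
  using spd by (simp add: self_adjoint_pos_def_def)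

lemma ip_pos: "x \<noteq> 0 \<Longrightarrow> ip x x > 0"
  using spd by (simp add: self_adjoint_pos_def_def)

lemma ip_simps:
  "ip (x + y) z = ip x z + ip y z" "ip x (y + z) = ip x y + ip x z"
  "ip (x - y) z = ip x z - ip y z" "ip x (y - z) = ip x y - ip x z"
  "ip (c *\<^sub>R x) y = c * ip x y" "ip x (c *\<^sub>R y) = c * ip x y"
  "ip (- x) y = - ip x y" "ip x (- y) = - ip x y"
  "ip 0 y = 0" "ip x 0 = 0"
  using linear_B
  by (simp_all add: linear_add linear_diff linear_cmul linear_neg linear_0 blinfun.bilinear_simps)

lemma ip_nonneg: "ip x x \<ge> 0"
  using ip_pos[of x] by (cases "x = 0") (auto simp: ip_simps)

lemma pn_nonneg: "pn x \<ge> 0"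
  by (simp add: primal_norm_def ip_nonneg)

lemma pn_square: "(pn x)\<^sup>2 = ip x x"
  by (simp add: primal_norm_def ip_nonneg)

lemma pn_zero [simp]: "pn 0 = 0"
  by (simp add: primal_norm_def ip_simps)

lemma pn_eq_0_iff [simp]: "pn x = 0 \<longleftrightarrow> x = 0"
  using ip_pos[of x] by (force simp: primal_norm_def ip_simps)

lemma pn_pos: "x \<noteq> 0 \<Longrightarrow> pn x > 0"
  using pn_nonneg[of x] by (simp add: order_less_le)

lemma pn_scaleR: "pn (c *\<^sub>R x) = \<bar>c\<bar> * pn x"
  by (simp add: primal_norm_def ip_simps real_sqrt_mult mult.assoc[symmetric])

lemma pn_minus_commute: "pn (x - y) = pn (y - x)"
  by (simp add: primal_norm_def ip_simps)

lemma pn_minus [simp]: "pn (- x) = pn x"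
  by (simp add: primal_norm_def ip_simps)

lemma ip_abs_le: "\<bar>ip x y\<bar> \<le> pn x * pn y"
proof (cases "y = 0")
  case False
  define c where "c = ip x y / ip y y"
  have yy: "ip y y > 0" by (rule ip_pos[OF False])
  have "0 \<le> ip (x - c *\<^sub>R y) (x - c *\<^sub>R y)" by (rule ip_nonneg)
  also have "\<dots> = ip x x - (ip x y)\<^sup>2 / ip y y"
    using yy by (simp add: ip_simps ip_commute[of y x] c_def power2_eq_square)
  finally have "(ip x y)\<^sup>2 \<le> ip x x * ip y y"
    using yy by (simp add: divide_le_eq)
  also have "\<dots> = (pn x * pn y)\<^sup>2"
    by (simp add: power_mult_distrib pn_square)
  finally show ?thesis
    using pn_nonneg by (simp add: abs_le_square_iff[symmetric] abs_mult)
qed (simp add: ip_simps)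

lemma continuous_on_ip:
  assumes "continuous_on S u" "continuous_on S w"
  shows "continuous_on S (\<lambda>t. ip (u t) (w t))"
proof -
  have "bounded_linear B" using linear_B by (rule linear_conv_bounded_linear[THEN iffD1])
  then show ?thesis
    using assms by (intro continuous_intros) (rule bounded_linear.continuous_on)
qed

lemma continuous_on_pn:
  assumes "continuous_on S u"
  shows "continuous_on S (\<lambda>t. pn (u t))"
  unfolding primal_norm_def by (intro continuous_intros continuous_on_ip assms)

section \<open>Comparison with the Euclidean norm, and the dual norm\<close>

lemma pn_ge_norm: obtains c where "c > 0" "\<And>x. c * norm x \<le> pn x"
proof -
  \<comment> \<open>The constant is the minimum of \<open>pn\<close> on the Euclidean unit sphere.
    The comparison transfers compactness from the topology of the type to balls and spheres of
    \<open>pn\<close>.\<close>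
  obtain s where s: "s \<in> sphere (0::'a) 1" "\<And>x. x \<in> sphere 0 1 \<Longrightarrow> pn s \<le> pn x"
  proof -
    obtain b :: 'a where "b \<in> Basis" using nonempty_Basis by blast
    then have "b \<in> sphere 0 1" by simp
    moreover have "continuous_on (sphere (0::'a) 1) pn"
      by (rule continuous_on_pn) (rule continuous_on_id)
    ultimately show ?thesis
      using that continuous_attains_inf[OF compact_sphere] by (metis empty_iff)
  qed
  have "s \<noteq> 0" using s(1) by auto
  moreover have "pn s * norm x \<le> pn x" for x
  proof (cases "x = 0")
    case False
    then have "pn s \<le> pn ((1 / norm x) *\<^sub>R x)" by (intro s(2)) simp
    then show ?thesis using False by (simp add: pn_scaleR field_simps)
  qed simp
  ultimately show ?thesis using that pn_pos by blast
qed

lemma compact_pn_sphere: "compact {x. pn x = 1}"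
proof -
  obtain c where c: "c > 0" "\<And>x. c * norm x \<le> pn x" by (rule pn_ge_norm) blast
  have "norm x \<le> 1 / c" if "pn x = 1" for x
    using c(2)[of x] c(1) that by (simp add: field_simps)
  then have "bounded {x. pn x = 1}" by (auto simp: bounded_iff)
  moreover have "closed {x. pn x = 1}"
    by (intro closed_Collect_eq continuous_on_pn continuous_intros)
  ultimately show ?thesis by (simp add: compact_eq_bounded_closed)
qed

lemma compact_pn_ball: "compact {x. pn x \<le> 1}"
proof -
  obtain c where c: "c > 0" "\<And>x. c * norm x \<le> pn x" by (rule pn_ge_norm) blast
  have "norm x \<le> 1 / c" if "pn x \<le> 1" for x
    using c(2)[of x] c(1) that by (simp add: field_simps)
  then have "bounded {x. pn x \<le> 1}" by (auto simp: bounded_iff)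
  moreover have "closed {x. pn x \<le> 1}"
    by (intro closed_Collect_le continuous_on_pn continuous_intros)
  ultimately show ?thesis by (simp add: compact_eq_bounded_closed)
qed

text \<open>\<open>dual_norm\<close> is stated with \<open>inv B\<close>, which is meaningful only
  once \<open>B\<close> is onto. The inner product turns \<open>B\<close> into an endomorphism
  \<open>L\<close>, for which injectivity implies surjectivity, and represents every functional by
  some vector \<open>w\<close>.\<close>

lemma bij_B: "bij B"
proof (rule bijI)
  show inj: "inj B"
  proof (rule injI)
    fix x y assume "B x = B y"
    then have "ip (x - y) (x - y) = 0" by (simp add: ip_simps)
    then show "x = y" using ip_pos[of "x - y"] by auto
  qed
  define L :: "'a \<Rightarrow> 'a" where "L x = (\<Sum>b\<in>Basis. ip x b *\<^sub>R b)" for x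
  have L: "L x \<bullet> y = ip x y" for x y
  proof -
    have "ip x y = ip x (\<Sum>b\<in>Basis. (y \<bullet> b) *\<^sub>R b)" by (simp add: euclidean_representation)
    also have "\<dots> = (\<Sum>b\<in>Basis. (y \<bullet> b) * ip x b)" by (simp add: blinfun.bilinear_simps)
    finally show ?thesis
      by (simp add: L_def inner_sum_left inner_commute[of y] mult.commute)
  qed
  have "linear L"
    by (rule linearI) (simp_all add: L_def ip_simps scaleR_left_distrib sum.distrib scaleR_sum_right)
  moreover have "inj L"
    by (rule injI) (metis L blinfun_eqI inj injD)
  ultimately have "surj L" by (rule linear_inj_imp_surj)
  show "surj B"
  proof (rule surjI)
    fix s :: "'a \<Rightarrow>\<^sub>L real"
    define w :: 'a where "w = (\<Sum>b\<in>Basis. blinfun_apply s b *\<^sub>R b)"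
    have "blinfun_apply s y = w \<bullet> y" for y
    proof -
      have "blinfun_apply s y = blinfun_apply s (\<Sum>b\<in>Basis. (y \<bullet> b) *\<^sub>R b)"
        by (simp add: euclidean_representation)
      then show ?thesis
        by (simp add: w_def blinfun.bilinear_simps inner_sum_left inner_commute[of y] mult.commute)
    qed
    moreover have "ip (inv L w) y = w \<bullet> y" for y
      by (simp add: L[symmetric] surj_f_inv_f[OF \<open>surj L\<close>])
    ultimately show "B (inv L (\<Sum>b\<in>Basis. blinfun_apply s b *\<^sub>R b)) = s"
      unfolding w_def[symmetric] by (intro blinfun_eqI) simp
  qed
qed

lemma B_inv_B: "B (inv B s) = s"
  using bij_B by (simp add: bij_is_surj surj_f_inv_f)

lemma inv_B_B: "inv B (B x) = x"
  using bij_B by (simp add: bij_is_inj)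

lemma dn_eq_pn: "dn s = pn (inv B s)"
  by (simp add: dual_norm_def primal_norm_def B_inv_B)

lemma dn_nonneg: "dn s \<ge> 0"
  by (simp add: dn_eq_pn pn_nonneg)

lemma apply_le_dn: "\<bar>blinfun_apply s x\<bar> \<le> dn s * pn x"
  using ip_abs_le[of "inv B s" x] by (simp add: dn_eq_pn B_inv_B)

text \<open>The bound is tested at \<open>inv B s\<close>, where the functional attains its norm. If
  \<open>dn s = 0\<close>, what remains is c >= 0, which any nonzero vector provides.\<close>

lemma dn_leI:
  assumes "\<And>x. \<bar>blinfun_apply s x\<bar> \<le> c * pn x"
  shows "dn s \<le> c"
proof (cases "dn s = 0")
  case True
  obtain b :: 'a where "b \<in> Basis" using nonempty_Basis by blast
  then have "pn b > 0" by (intro pn_pos) (use nonzero_Basis in blast)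
  moreover have "0 \<le> c * pn b" using assms[of b] by linarith
  ultimately show ?thesis using True by (simp add: zero_le_mult_iff)
next
  case False
  have "dn s * dn s = blinfun_apply s (inv B s)"
    using pn_square[of "inv B s"] by (simp add: dn_eq_pn B_inv_B power2_eq_square)
  also have "\<dots> \<le> c * dn s" using assms[of "inv B s"] by (simp add: dn_eq_pn)
  finally show ?thesis using False dn_nonneg[of s] by simp
qed

lemma dn_triangle: "dn (s + t) \<le> dn s + dn t"
proof (rule dn_leI)
  fix x
  show "\<bar>blinfun_apply (s + t) x\<bar> \<le> (dn s + dn t) * pn x"
    using apply_le_dn[of s x] apply_le_dn[of t x] by (simp add: blinfun.bilinear_simps algebra_simps)
qed

lemma dn_minus: "dn (- s) = dn s"
proof (rule antisym)
  show "dn (- s) \<le> dn s"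
    by (rule dn_leI) (use apply_le_dn[of s] in \<open>simp add: blinfun.bilinear_simps\<close>)
  show "dn s \<le> dn (- s)"
    by (rule dn_leI) (use apply_le_dn[of "- s"] in \<open>simp add: blinfun.bilinear_simps\<close>)
qed

lemma dn_scaleR_B: "dn (k *\<^sub>R B u) = \<bar>k\<bar> * pn u"
  using inv_B_B[of "k *\<^sub>R u"] linear_B by (simp add: dn_eq_pn linear_cmul pn_scaleR)

text \<open>The dual norm is Euclidean as well, so an upper bound on the norm of a perturbed
  gradient becomes a bound on its pairing with \<open>u\<close>.\<close>

lemma dn_square_add_B:
  "(dn (s + k *\<^sub>R B u))\<^sup>2 = (dn s)\<^sup>2 + 2 * k * blinfun_apply s u + k\<^sup>2 * (pn u)\<^sup>2"
proof -
  define w where "w = inv B s"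
  have s: "s = B w" by (simp add: w_def B_inv_B)
  have "s + k *\<^sub>R B u = B (w + k *\<^sub>R u)"
    using linear_B by (simp add: s linear_add linear_cmul)
  then show ?thesis
    by (simp add: s dn_eq_pn inv_B_B pn_square ip_simps ip_commute[of u w] power2_eq_square[of k] algebra_simps)
qed

end

section \<open>Symmetric multilinear forms\<close>

text \<open>Forms act on lists, to match \<open>higher_deriv\<close>, and only lists of length n are
  constrained. Linearity in the first slot together with invariance under permutations gives
  linearity in every slot.\<close>

definition sym_form :: "nat \<Rightarrow> ('a::euclidean_space list \<Rightarrow> real) \<Rightarrow> bool" where
  "sym_form n F \<longleftrightarrow>
     (\<forall>hs. Suc (length hs) = n \<longrightarrow> linear (\<lambda>h. F (h # hs))) \<and>
     (\<forall>hs ks. length hs = n \<longrightarrow> mset hs = mset ks \<longrightarrow> F hs = F ks)"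

lemma sym_form_linear: "sym_form (Suc n) F \<Longrightarrow> length hs = n \<Longrightarrow> linear (\<lambda>h. F (h # hs))"
  by (simp add: sym_form_def)

lemma sym_form_perm: "sym_form n F \<Longrightarrow> length hs = n \<Longrightarrow> mset hs = mset ks \<Longrightarrow> F hs = F ks"
  unfolding sym_form_def by blast

text \<open>Freezing one argument lowers the degree; the inductions on the degree below rest on
  this.\<close>

lemma sym_form_Cons:
  assumes "sym_form (Suc n) F"
  shows "sym_form n (\<lambda>hs. F (h # hs))"
  unfolding sym_form_def
proof (intro conjI allI impI)
  fix hs :: "'a list" assume hs: "Suc (length hs) = n"
  have "F (h # k # hs) = F (k # h # hs)" for k
    by (rule sym_form_perm[OF assms]) (use hs in auto)
  moreover have "linear (\<lambda>k. F (k # h # hs))"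
    by (rule sym_form_linear[OF assms]) (use hs in auto)
  ultimately show "linear (\<lambda>k. F (h # k # hs))" by simp
next
  fix hs ks :: "'a list" assume "length hs = n" "mset hs = mset ks"
  then show "F (h # hs) = F (h # ks)" by (intro sym_form_perm[OF assms]) auto
qed

lemma sym_form_diff:
  assumes "sym_form n F" "sym_form n G"
  shows "sym_form n (\<lambda>hs. F hs - G hs)"
  using assms unfolding sym_form_def by (auto intro!: linear_compose_sub)

lemma sym_form_euclidean_expansion:
  assumes "sym_form (Suc n) F" "length hs = n"
  shows "F (h # hs) = (\<Sum>b\<in>Basis. (h \<bullet> b) * F (b # hs))"
proof -
  note lin = sym_form_linear[OF assms]
  from linear_sum[OF lin, of "\<lambda>b. (h \<bullet> b) *\<^sub>R b" Basis] linear_cmul[OF lin]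
  show ?thesis by (simp add: euclidean_representation)
qed

lemma continuous_on_sym_form:
  assumes "sym_form (length us) F" "\<forall>u\<in>set us. continuous_on S u"
  shows "continuous_on S (\<lambda>t. F (map (\<lambda>u. u t) us))"
  using assms
proof (induction us arbitrary: F)
  case (Cons u us)
  have F: "sym_form (Suc (length us)) F" using Cons.prems by simp
  have "F (u t # map (\<lambda>u. u t) us) = (\<Sum>b\<in>Basis. (u t \<bullet> b) * F (b # map (\<lambda>u. u t) us))" for t
    by (rule sym_form_euclidean_expansion[OF F]) simp
  moreover have "continuous_on S (\<lambda>t. \<Sum>b\<in>Basis. (u t \<bullet> b) * F (b # map (\<lambda>u. u t) us))"
    using Cons.prems by (intro continuous_intros Cons.IH sym_form_Cons[OF F]) auto
  ultimately show ?case by simp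
qed simp

lemma sym_form_replicate_scale:
  assumes "sym_form n F"
  shows "F (replicate n (c *\<^sub>R h)) = c ^ n * F (replicate n h)"
  using assms
proof (induction n arbitrary: F)
  case (Suc n)
  have "F (c *\<^sub>R h # replicate n (c *\<^sub>R h)) = c * F (h # replicate n (c *\<^sub>R h))"
    using linear_cmul[OF sym_form_linear[OF Suc.prems, of "replicate n (c *\<^sub>R h)"]] by simp
  also have "F (h # replicate n (c *\<^sub>R h)) = c ^ n * F (h # replicate n h)"
    by (rule Suc.IH[OF sym_form_Cons[OF Suc.prems]])
  finally show ?case by simp
qed simp

section \<open>Banach's theorem and the diagonal norm\<close>

context spd_operator
begin

lemma pn_normalize: "x \<noteq> 0 \<Longrightarrow> pn ((1 / pn x) *\<^sub>R x) = 1"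
  using pn_pos[of x] by (simp add: pn_scaleR)

lemma ex_pn_unit: "\<exists>a. pn a = 1"
proof -
  obtain b :: 'a where "b \<in> Basis" using nonempty_Basis by blast
  then have "b \<noteq> 0" by (rule nonzero_Basis)
  then show ?thesis using pn_normalize by blast
qed

(* Replacing a maximising pair by its normalised sum keeps it maximising and lengthens the total
   sum, unless the two vectors coincide. *)
lemma symmetric_bilinear_maximiser:
  fixes G :: "'a \<Rightarrow> 'a \<Rightarrow> real"
  assumes lin: "\<And>v. linear (\<lambda>u. G u v)" and sym: "\<And>u v. G u v = G v u"
    and le: "\<And>u v. pn u = 1 \<Longrightarrow> pn v = 1 \<Longrightarrow> \<bar>G u v\<bar> \<le> M"
    and a: "pn a = 1" and b: "pn b = 1" and ab: "\<bar>G a b\<bar> = M"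
    and longest: "\<And>u v. pn u = 1 \<Longrightarrow> pn v = 1 \<Longrightarrow> \<bar>G u v\<bar> = M \<Longrightarrow> pn (s + u + v) \<le> pn (s + a + b)"
  shows "a = b"
proof -
  have G: "G (u + v) w = G u w + G v w" "G (u - v) w = G u w - G v w"
    "G (c *\<^sub>R u) w = c * G u w" "G (- u) w = - G u w" "G 0 w = 0"
    "G w (u + v) = G w u + G w v" "G w (u - v) = G w u - G w v"
    "G w (c *\<^sub>R u) = c * G w u" "G w (- u) = - G w u" "G w 0 = 0" for u v w c
    using linear_add[OF lin] linear_diff[OF lin] linear_cmul[OF lin] linear_neg[OF lin] linear_0[OF lin]
    by (auto simp: sym[of w])
  have longest': "ip (s + u + v) (s + u + v) \<le> ip (s + a + b) (s + a + b)"
    if "pn u = 1" "pn v = 1" "\<bar>G u v\<bar> = M" for u v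
    using power_mono[OF longest[OF that] pn_nonneg, of 2] by (simp add: pn_square)
  have unit: "ip a a = 1" "ip b b = 1"
    using pn_square[of a] pn_square[of b] a b by simp_all
  \<comment> \<open>The pair (-a, -b) is maximising too, so a + b cannot point away from s.\<close>
  have nonneg: "ip s (a + b) \<ge> 0"
    using longest'[of "- a" "- b"] a b ab
    by (simp add: G ip_simps ip_commute[of a s] ip_commute[of b s] ip_commute[of b a])
  show ?thesis
  proof (cases "a + b = 0")
    case True
    then have b_eq: "b = - a" by (simp add: eq_neg_iff_add_eq_0 add.commute)
    \<comment> \<open>Here s + a + b = s, while (a, a) and (-a, -a) are maximising pairs. The
      squared lengths of s + 2a and s - 2a average to |s|^2 + 4, so they cannot both be at most
      |s|^2.\<close>
    have "\<bar>G a a\<bar> = M" using ab by (simp add: b_eq G)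
    then have "ip (s + a + a) (s + a + a) \<le> ip s s" "ip (s - a - a) (s - a - a) \<le> ip s s"
      using longest'[of a a] longest'[of "- a" "- a"] a by (simp_all add: b_eq G)
    then show ?thesis
      using unit by (simp add: ip_simps ip_commute[of a s])
  next
    case False
    define k where "k = pn (a + b)"
    define m where "m = (1 / k) *\<^sub>R (a + b)"
    have k: "k > 0" using False by (simp add: k_def pn_pos)
    have m: "pn m = 1" using False by (simp add: m_def k_def pn_normalize)
    have k2: "k\<^sup>2 = 2 + 2 * ip a b" and diff2: "(pn (a - b))\<^sup>2 = 2 - 2 * ip a b"
      using unit by (simp_all add: k_def pn_square ip_simps ip_commute[of b a])
    have diag: "\<bar>G x x\<bar> \<le> M * (pn x)\<^sup>2" for x
    proof (cases "x = 0")
      case False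
      have "\<bar>G ((1 / pn x) *\<^sub>R x) ((1 / pn x) *\<^sub>R x)\<bar> \<le> M"
        by (intro le pn_normalize False)
      then show ?thesis
        using pn_pos[OF False] by (simp add: G abs_mult power2_eq_square field_simps)
    qed (simp add: G)
    \<comment> \<open>Polarization: since |a + b|^2 + |a - b|^2 = 4, the diagonal pair (m, m) has to
      be maximising as well.\<close>
    have "4 * M = \<bar>G (a + b) (a + b) - G (a - b) (a - b)\<bar>"
      using ab by (simp add: G sym[of b a])
    also have "\<dots> \<le> \<bar>G (a + b) (a + b)\<bar> + M * (2 - 2 * ip a b)"
      using diag[of "a - b"] by (simp add: diff2)
    finally have "M * k\<^sup>2 \<le> \<bar>G (a + b) (a + b)\<bar>"
      by (simp add: k2 algebra_simps)
    moreover have "G m m = G (a + b) (a + b) / k\<^sup>2"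
      unfolding m_def G(3,8) by (simp add: power2_eq_square)
    ultimately have "\<bar>G m m\<bar> = M * k\<^sup>2 / k\<^sup>2"
      using diag[of "a + b", folded k_def] by simp
    then have "\<bar>G m m\<bar> = M" using k by simp
    from longest'[OF m m this]
    have "4 * ip s m + 4 \<le> 2 * ip s (a + b) + k\<^sup>2"
      using unit pn_square[of m] m
      by (simp add: ip_simps ip_commute[of a s] ip_commute[of b s] ip_commute[of b a] ip_commute[of m s] k2)
    \<comment> \<open>Both summands are nonnegative because k <= 2. Hence k = 2, which forces a =
      b.\<close>
    then have "(4 / k - 2) * ip s (a + b) + (4 - k\<^sup>2) \<le> 0"
      by (simp add: m_def ip_simps algebra_simps add_divide_distrib)
    moreover have le4: "k\<^sup>2 \<le> 4"
      using zero_le_power2[of "pn (a - b)"] by (simp only: diff2 k2)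
    moreover have "k \<le> 2"
      using power2_le_imp_le[of k 2] le4 by simp
    then have "(4 / k - 2) * ip s (a + b) \<ge> 0"
      using k nonneg by (intro mult_nonneg_nonneg) (simp_all add: field_simps)
    ultimately have "k\<^sup>2 = 4" by linarith
    then have "(pn (a - b))\<^sup>2 = 0" by (simp add: diff2 k2)
    then show ?thesis by simp
  qed
qed

text \<open>Tuples are functions on all naturals, so that Tychonoff's theorem applies in the product
  topology; the form and the sum below read only the first n entries.\<close>

lemma compact_pn_unit_tuples: "compact {h::nat \<Rightarrow> 'a. \<forall>i. pn (h i) = 1}"
proof -
  have "{h::nat \<Rightarrow> 'a. \<forall>i. pn (h i) = 1} = PiE UNIV (\<lambda>_. {x. pn x = 1})"
    by (auto simp: PiE_def Pi_def)
  moreover have "compactin (product_topology (\<lambda>_. euclidean) UNIV) (PiE (UNIV::nat set) (\<lambda>_. {x. pn x = 1}))"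
    using compact_pn_sphere by (simp add: compactin_PiE)
  ultimately show ?thesis
    by (simp add: euclidean_product_topology)
qed

(* Banach's theorem on symmetric multilinear forms: among the maximising tuples, one with the
   longest sum is constant. *)
theorem sym_form_maximal_on_diagonal:
  assumes F: "sym_form n F"
  obtains a where "pn a = 1"
    "\<And>h. (\<And>i. i < n \<Longrightarrow> pn (h i) = 1) \<Longrightarrow> \<bar>F (map h [0..<n])\<bar> \<le> \<bar>F (replicate n a)\<bar>"
proof -
  define K where "K = {h::nat \<Rightarrow> 'a. \<forall>i. pn (h i) = 1}"
  define \<Phi> where "\<Phi> h = \<bar>F (map h [0..<n])\<bar>" for h
  define sm where "sm h = (\<Sum>i<n. h i)" for h :: "nat \<Rightarrow> 'a"
  obtain e where e: "pn e = 1" using ex_pn_unit by blast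
  have K: "compact K" "K \<noteq> {}"
    using compact_pn_unit_tuples e by (auto simp: K_def)
  have cont: "continuous_on UNIV \<Phi>"
  proof -
    have "continuous_on UNIV (\<lambda>h. F (map (\<lambda>u. u h) (map (\<lambda>i h. h i) [0..<n])))"
      by (rule continuous_on_sym_form) (use F in auto)
    then show ?thesis unfolding \<Phi>_def by (intro continuous_intros) (simp add: comp_def)
  qed
  obtain h0 where h0: "h0 \<in> K" "\<And>h. h \<in> K \<Longrightarrow> \<Phi> h \<le> \<Phi> h0"
    using continuous_attains_sup[OF K continuous_on_subset[OF cont]] by auto
  define S where "S = K \<inter> {h. \<Phi> h = \<Phi> h0}"
  have "compact S" unfolding S_def
    by (intro compact_Int_closed K closed_Collect_eq cont continuous_intros)
  moreover have "S \<noteq> {}" using h0 by (auto simp: S_def)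
  moreover have "continuous_on UNIV (\<lambda>h. pn (sm h))"
    unfolding sm_def by (intro continuous_on_pn continuous_on_sum continuous_on_product_coordinates)
  ultimately obtain h where h: "h \<in> S" "\<And>k. k \<in> S \<Longrightarrow> pn (sm k) \<le> pn (sm h)"
    using continuous_attains_sup[of S "\<lambda>h. pn (sm h)"] continuous_on_subset by (metis subset_UNIV)
  have hK: "pn (h i) = 1" for i using h(1) by (simp add: S_def K_def)
  have const: "h i = h j" if ij: "i < n" "j < n" "i \<noteq> j" for i j
  proof -
    define rest where "rest = map h (filter (\<lambda>k. k \<noteq> i \<and> k \<noteq> j) [0..<n])"
    define G where "G u v = F (u # v # rest)" for u v
    have ms: "mset (u # v # rest) = mset (map (h(i := u, j := v)) [0..<n])" for u v
    proof -
      have "mset [0..<n] = mset (i # j # filter (\<lambda>k. k \<noteq> i \<and> k \<noteq> j) [0..<n])"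
        using ij by (subst set_eq_iff_mset_eq_distinct[symmetric]) auto
      then have "image_mset (h(i := u, j := v)) (mset [0..<n]) =
          image_mset (h(i := u, j := v)) (mset (i # j # filter (\<lambda>k. k \<noteq> i \<and> k \<noteq> j) [0..<n]))"
        by simp
      also have "\<dots> = mset (map (h(i := u, j := v)) (i # j # filter (\<lambda>k. k \<noteq> i \<and> k \<noteq> j) [0..<n]))"
        by (simp only: mset_map)
      also have "map (h(i := u, j := v)) (i # j # filter (\<lambda>k. k \<noteq> i \<and> k \<noteq> j) [0..<n]) = u # v # rest"
        using ij by (simp add: rest_def)
      finally show ?thesis by (simp only: mset_map)
    qed
    have len: "Suc (Suc (length rest)) = n"
      using arg_cong[OF ms[of "h i" "h j"], of size] by simp
    have GF: "G u v = F (map (h(i := u, j := v)) [0..<n])" for u v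
      unfolding G_def by (rule sym_form_perm[OF F]) (use ms len in auto)
    have upd: "h(i := u, j := v) \<in> K" if "pn u = 1" "pn v = 1" for u v
      using that hK by (simp add: K_def)
    define R where "R = {..<n} - {i, j}"
    have R: "finite R" "i \<notin> R" "j \<notin> R" "{..<n} = insert i (insert j R)"
      using ij by (auto simp: R_def)
    define s where "s = (\<Sum>k\<in>R. h k)"
    have sm: "sm (h(i := u, j := v)) = s + u + v" for u v
    proof -
      have "(\<Sum>k\<in>R. (h(i := u, j := v)) k) = s"
        unfolding s_def by (rule sum.cong) (use R in auto)
      then show ?thesis
        using R(1-3) ij(3) by (simp add: sm_def R(4) ac_simps)
    qed
    have h_upd: "h(i := h i, j := h j) = h" by simp
    show ?thesis
    proof (rule symmetric_bilinear_maximiser[of G "\<Phi> h0" _ _ s])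
      show "linear (\<lambda>u. G u v)" for v
        unfolding G_def by (rule sym_form_linear[of "n - 1"]) (use F len in auto)
      show "G u v = G v u" for u v
        unfolding G_def by (rule sym_form_perm[OF F]) (use len in auto)
      show "\<bar>G u v\<bar> \<le> \<Phi> h0" if "pn u = 1" "pn v = 1" for u v
        using h0(2)[OF upd[OF that]] by (simp add: GF \<Phi>_def)
      show "\<bar>G (h i) (h j)\<bar> = \<Phi> h0"
        using h(1) unfolding GF h_upd by (simp add: S_def \<Phi>_def)
      show "pn (s + u + v) \<le> pn (s + h i + h j)"
        if "pn u = 1" "pn v = 1" "\<bar>G u v\<bar> = \<Phi> h0" for u v
      proof -
        have "h(i := u, j := v) \<in> S"
          using upd[OF that(1,2)] that(3) by (simp add: S_def GF \<Phi>_def)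
        from h(2)[OF this] show ?thesis
          using sm[of u v] sm[of "h i" "h j"] by (simp only: h_upd)
      qed
    qed (use hK in auto)
  qed
  show ?thesis
  proof (rule that[of "h 0"])
    fix k assume k: "\<And>i. i < n \<Longrightarrow> pn (k i) = 1"
    \<comment> \<open>The vectors \<open>k i\<close> are unit only for i < n, while membership in
      \<open>K\<close> concerns every index.\<close>
    define k' where "k' i = (if i < n then k i else e)" for i
    have "k' \<in> K" using k e by (simp add: K_def k'_def)
    then have "\<Phi> k' \<le> \<Phi> h0" by (rule h0(2))
    moreover have "map k' [0..<n] = map k [0..<n]" by (simp add: k'_def)
    moreover have const_0: "h i = h 0" if "i < n" for i
      using const[of i 0] that by (cases "i = 0") auto
    have "map h [0..<n] = map (\<lambda>_. h 0) [0..<n]"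
      by (intro map_cong refl const_0) simp
    then have "map h [0..<n] = replicate n (h 0)"
      by (simp only: map_replicate_trivial)
    moreover have "\<Phi> h0 = \<Phi> h" using h(1) by (simp add: S_def)
    ultimately show "\<bar>F (map k [0..<n])\<bar> \<le> \<bar>F (replicate n (h 0))\<bar>"
      by (simp add: \<Phi>_def)
  qed (rule hK)
qed

text \<open>A real supremum dominates its members only if they are bounded above; compactness of the
  unit ball supplies this.\<close>

lemma le_form_norm:
  assumes F: "sym_form n F" and "pn a \<le> 1"
  shows "\<bar>F (replicate n a)\<bar> \<le> form_norm B n F"
  unfolding form_norm_def
proof (rule cSUP_upper)
  have "continuous_on {h. pn h \<le> 1} (\<lambda>h. F (map (\<lambda>u. u h) (replicate n (\<lambda>h. h))))"
    by (rule continuous_on_sym_form) (use F in \<open>auto intro: continuous_on_id\<close>)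
  then have "continuous_on {h. pn h \<le> 1} (\<lambda>h. \<bar>F (replicate n h)\<bar>)"
    by (intro continuous_intros) simp
  then show "bdd_above ((\<lambda>h. \<bar>F (replicate n h)\<bar>) ` {h. pn h \<le> 1})"
    by (intro bounded_imp_bdd_above compact_imp_bounded compact_continuous_image compact_pn_ball)
qed (use assms in simp)

lemma form_norm_nonneg: "sym_form n F \<Longrightarrow> form_norm B n F \<ge> 0"
  using le_form_norm[of n F 0] by force

text \<open>\<open>form_norm\<close> sees equal arguments only. Banach's theorem covers mixed unit
  vectors, and homogeneity in each slot does the rest.\<close>

lemma sym_form_le_form_norm:
  assumes F: "sym_form (Suc n) F"
  shows "\<bar>F (u # replicate n h)\<bar> \<le> form_norm B (Suc n) F * pn u * pn h ^ n"
proof -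
  obtain a where a: "pn a = 1"
    "\<And>k. (\<And>i. i < Suc n \<Longrightarrow> pn (k i) = 1) \<Longrightarrow> \<bar>F (map k [0..<Suc n])\<bar> \<le> \<bar>F (replicate (Suc n) a)\<bar>"
    using sym_form_maximal_on_diagonal[OF F] by blast
  have unit: "\<bar>F (u # replicate n h)\<bar> \<le> form_norm B (Suc n) F" if "pn u = 1" "pn h = 1" for u h
  proof -
    have "map (\<lambda>i. if i = 0 then u else h) [0..<Suc n] = u # replicate n h"
      by (rule nth_equalityI) (auto simp: nth_Cons' simp del: upt_Suc)
    then have "\<bar>F (u # replicate n h)\<bar> \<le> \<bar>F (replicate (Suc n) a)\<bar>"
      using a(2)[of "\<lambda>i. if i = 0 then u else h"] that by simp
    also have "\<dots> \<le> form_norm B (Suc n) F"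
      by (rule le_form_norm[OF F]) (simp add: a)
    finally show ?thesis .
  qed
  have lin: "F (c *\<^sub>R u # hs) = c * F (u # hs)" if "length hs = n" for c u hs
    using linear_cmul[OF sym_form_linear[OF F that]] by simp
  have hom: "F (u # replicate n (c *\<^sub>R h)) = c ^ n * F (u # replicate n h)" for c u h
    by (rule sym_form_replicate_scale[OF sym_form_Cons[OF F]])
  have u1: "u = pn u *\<^sub>R ((1 / pn u) *\<^sub>R u)" if "u \<noteq> 0" for u
    using that by simp
  have nn: "form_norm B (Suc n) F \<ge> 0" by (rule form_norm_nonneg[OF F])
  show ?thesis
  proof (cases "u = 0 \<or> (h = 0 \<and> n \<noteq> 0)")
    case True
    then have "F (u # replicate n h) = 0"
      using lin[of "replicate n h" 0 u] hom[of u 0 h] by (auto simp: power_0_left)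
    then show ?thesis using nn pn_nonneg by simp
  next
    case False
    define u' where "u' = (1 / pn u) *\<^sub>R u"
    have u: "u = pn u *\<^sub>R u'" "pn u' = 1"
      using False u1 by (auto simp: u'_def pn_normalize)
    \<comment> \<open>For n = 0 no copy of h occurs, so h may vanish and any unit vector
      serves.\<close>
    obtain h' where h': "replicate n h = replicate n (pn h *\<^sub>R h')" "pn h' = 1"
    proof (cases "n = 0")
      case True
      then show ?thesis using that[of a] a(1) by simp
    next
      case False
      then have "h \<noteq> 0" using \<open>\<not> (u = 0 \<or> (h = 0 \<and> n \<noteq> 0))\<close> by simp
      then show ?thesis using that[of "(1 / pn h) *\<^sub>R h"] by (simp add: pn_normalize)
    qed
    have "F (u # replicate n h) = pn u * (pn h ^ n * F (u' # replicate n h'))"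
      by (subst u(1)) (simp add: h'(1) lin hom)
    then have "\<bar>F (u # replicate n h)\<bar> = pn u * pn h ^ n * \<bar>F (u' # replicate n h')\<bar>"
      using pn_nonneg by (simp add: abs_mult)
    also have "\<dots> \<le> pn u * pn h ^ n * form_norm B (Suc n) F"
      by (intro mult_left_mono unit u h') (simp add: pn_nonneg)
    finally show ?thesis by (simp add: mult_ac)
  qed
qed

end

section \<open>Higher derivatives and Taylor models\<close>

text \<open>The mean value theorem along u, applied to the increment of g in direction s v, turns
  the second difference into s times a difference of \<open>D\<close> at two points within O(s) of
  x. Differentiability of w |-> D w u at the single point x then identifies the limit. The quotient
  is symmetric in u and v, which is what Schwarz's theorem needs.\<close>

lemma second_difference_quotient_tendsto:
  fixes g :: "'a::real_normed_vector \<Rightarrow> real"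
  assumes g: "\<And>w. (g has_derivative D w) (at w)"
    and D: "((\<lambda>w. D w u) has_derivative L) (at x)"
  shows "((\<lambda>s. (g (x + s *\<^sub>R u + s *\<^sub>R v) - g (x + s *\<^sub>R u) - g (x + s *\<^sub>R v) + g x) / s\<^sup>2)
           \<longlongrightarrow> L v) (at_right 0)"
proof (rule tendstoI)
  fix e :: real assume e: "e > 0"
  \<comment> \<open>The two evaluation points have total distance at most s (2 |u| + |v|) from x;
    the summand 1 makes this strictly less than s K.\<close>
  define K where "K = 2 * norm u + norm v + 1"
  have K: "K > 0" unfolding K_def by (simp add: add_nonneg_pos)
  obtain d where d: "d > 0"
    "\<And>y. norm (y - x) < d \<Longrightarrow> \<bar>D y u - D x u - L (y - x)\<bar> \<le> e / (2 * K) * norm (y - x)"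
    using D e K unfolding has_derivative_at_alt real_norm_def
    by (metis divide_pos_pos mult_pos_pos zero_less_numeral)
  interpret L: bounded_linear L using D by (rule has_derivative_bounded_linear)
  have "dist ((g (x + s *\<^sub>R u + s *\<^sub>R v) - g (x + s *\<^sub>R u) - g (x + s *\<^sub>R v) + g x) / s\<^sup>2) (L v) < e"
    if s: "0 < s" "s < d / K" for s
  proof -
    have "\<exists>\<xi>. 0 < \<xi> \<and> \<xi> < s \<and>
        (g (x + s *\<^sub>R u + s *\<^sub>R v) - g (x + s *\<^sub>R u)) - (g (x + 0 *\<^sub>R u + s *\<^sub>R v) - g (x + 0 *\<^sub>R u))
          = (s - 0) * (D (x + \<xi> *\<^sub>R u + s *\<^sub>R v) u - D (x + \<xi> *\<^sub>R u) u)"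
    proof (rule MVT2[OF s(1)])
      fix \<tau>
      have line: "((\<lambda>\<tau>. g (c + \<tau> *\<^sub>R u)) has_real_derivative D (c + \<tau> *\<^sub>R u) u) (at \<tau>)" for c
      proof -
        have "((\<lambda>\<tau>. g (c + \<tau> *\<^sub>R u)) has_derivative (\<lambda>h. D (c + \<tau> *\<^sub>R u) (h *\<^sub>R u))) (at \<tau>)"
          by (rule has_derivative_compose[OF _ g]) (auto intro!: derivative_eq_intros)
        moreover have "linear (D (c + \<tau> *\<^sub>R u))"
          using g has_derivative_linear by blast
        ultimately show ?thesis
          by (simp add: has_field_derivative_def linear_cmul mult_commute_abs)
      qed
      show "((\<lambda>\<tau>. g (x + \<tau> *\<^sub>R u + s *\<^sub>R v) - g (x + \<tau> *\<^sub>R u)) has_real_derivative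
          D (x + \<tau> *\<^sub>R u + s *\<^sub>R v) u - D (x + \<tau> *\<^sub>R u) u) (at \<tau>)"
        using DERIV_diff[OF line[of "x + s *\<^sub>R v"] line[of x]]
        by (simp add: add.commute add.left_commute)
    qed
    then obtain \<xi> where \<xi>: "0 < \<xi>" "\<xi> < s"
      "g (x + s *\<^sub>R u + s *\<^sub>R v) - g (x + s *\<^sub>R u) - g (x + s *\<^sub>R v) + g x
         = s * (D (x + \<xi> *\<^sub>R u + s *\<^sub>R v) u - D (x + \<xi> *\<^sub>R u) u)"
      by (auto simp: algebra_simps)
    define a where "a = x + \<xi> *\<^sub>R u + s *\<^sub>R v"
    define b where "b = x + \<xi> *\<^sub>R u"
    have nb: "norm (b - x) \<le> s * norm u"
      using \<xi> by (simp add: b_def mult_right_mono)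
    have "norm (a - x) \<le> norm (\<xi> *\<^sub>R u) + norm (s *\<^sub>R v)"
      using norm_triangle_ineq[of "\<xi> *\<^sub>R u" "s *\<^sub>R v"] by (simp add: a_def add.assoc)
    then have na: "norm (a - x) \<le> s * norm u + s * norm v"
      using \<xi> s mult_right_mono[of \<xi> s "norm u"] by simp
    have sK: "s * norm u + s * norm v + s * norm u < s * K"
      using s by (simp add: K_def algebra_simps)
    have s0: "0 \<le> s * norm u" "0 \<le> s * norm v" using s by simp_all
    have "s * K < d" using s K by (simp add: pos_less_divide_eq)
    then have "norm (a - x) < d" "norm (b - x) < d"
      using na nb sK s0 by linarith+
    then have "\<bar>D a u - D x u - L (a - x)\<bar> \<le> e / (2 * K) * norm (a - x)"
      "\<bar>D b u - D x u - L (b - x)\<bar> \<le> e / (2 * K) * norm (b - x)"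
      using d(2) by auto
    moreover have "L (a - x) - L (b - x) = s * L v"
      by (simp add: a_def b_def L.scaleR L.add)
    ultimately have "\<bar>(D a u - D b u) - s * L v\<bar> \<le> e / (2 * K) * (norm (a - x) + norm (b - x))"
      unfolding distrib_left by linarith
    also have "\<dots> \<le> e / (2 * K) * (s * K)"
      using e K na nb sK by (intro mult_left_mono) auto
    also have "\<dots> = e / 2 * s" using K by simp
    also have "\<dots> < e * s" using e s by simp
    finally have "\<bar>(D a u - D b u) - s * L v\<bar> < e * s" .
    moreover have "s * (D a u - D b u) / s\<^sup>2 - L v = ((D a u - D b u) - s * L v) / s"
      using s by (simp add: power2_eq_square field_simps)
    ultimately have "\<bar>s * (D a u - D b u) / s\<^sup>2 - L v\<bar> < e"
      using s by (simp add: abs_divide pos_divide_less_eq)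
    then show ?thesis unfolding dist_real_def \<xi>(3) a_def b_def .
  qed
  then show "\<forall>\<^sub>F s in at_right 0.
      dist ((g (x + s *\<^sub>R u + s *\<^sub>R v) - g (x + s *\<^sub>R u) - g (x + s *\<^sub>R v) + g x) / s\<^sup>2) (L v) < e"
    using d(1) K unfolding eventually_at_right_field by (meson divide_pos_pos)
qed

(* Schwarz's theorem, without continuity of the second derivative. *)
lemma second_derivative_symmetric:
  fixes g :: "'a::real_normed_vector \<Rightarrow> real"
  assumes g: "\<And>w. (g has_derivative D w) (at w)"
    and u: "((\<lambda>w. D w u) has_derivative L) (at x)"
    and v: "((\<lambda>w. D w v) has_derivative M) (at x)"
  shows "L v = M u"
proof -
  have "((\<lambda>s. (g (x + s *\<^sub>R u + s *\<^sub>R v) - g (x + s *\<^sub>R u) - g (x + s *\<^sub>R v) + g x) / s\<^sup>2)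
           \<longlongrightarrow> M u) (at_right 0)"
    using second_difference_quotient_tendsto[OF g v, of u] by (simp add: algebra_simps)
  then show ?thesis
    by (rule tendsto_unique[OF trivial_limit_at_right_real second_difference_quotient_tendsto[OF g u]])
qed

lemma has_derivative_higher_deriv:
  assumes "times_differentiable p f" "length hs < p"
  shows "(higher_deriv f hs has_derivative (\<lambda>h. higher_deriv f (h # hs) x)) (at x)"
  using assms frechet_derivative_works by (force simp: times_differentiable_def)

text \<open>If the heads h and k differ, induction rearranges the tails so that the lists become h #
  k # ms and k # h # ms, and Schwarz's theorem swaps the two outermost derivatives. Equality of
  functions, not just of values at a point, is what allows differentiating rearranged tails.\<close>

lemma higher_deriv_perm:
  assumes f: "times_differentiable p f" and "length hs \<le> p" "mset hs = mset ks"
  shows "higher_deriv f hs = higher_deriv f ks"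
  using assms(2,3)
proof (induction "length hs" arbitrary: hs ks)
  case (Suc n)
  obtain h hs' where hs: "hs = h # hs'" using Suc.hyps(2) by (cases hs) auto
  obtain k ks' where ks: "ks = k # ks'" using Suc.prems(2) hs by (cases ks) auto
  have IH: "higher_deriv f xs = higher_deriv f ys"
    if "length xs = n" "mset xs = mset ys" for xs ys
    by (rule Suc.hyps(1)) (use that Suc in auto)
  show ?case
  proof (cases "h = k")
    case True
    then have "higher_deriv f hs' = higher_deriv f ks'"
      using Suc.prems Suc.hyps(2) by (intro IH) (auto simp: hs ks)
    then show ?thesis by (simp add: hs ks True)
  next
    case False
    have m: "add_mset h (mset hs') = add_mset k (mset ks')" using Suc.prems hs ks by simp
    then have "h \<in> set ks'" using False by (metis insert_noteq_member set_mset_mset)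
    then obtain ms where ms: "mset ks' = mset (h # ms)"
      using that[of "remove1 h ks'"] by simp
    then have ms': "mset hs' = mset (k # ms)"
      using m by (simp add: add_mset_commute)
    have len: "Suc (Suc (length ms)) = length hs"
      using arg_cong[OF ms', of size] by (simp add: hs)
    have "higher_deriv f hs = higher_deriv f (h # k # ms)"
      using IH[of hs' "k # ms"] ms' Suc.hyps(2) by (simp add: hs)
    also have "\<dots> = higher_deriv f (k # h # ms)"
    proof
      fix x
      have 1: "(higher_deriv f ms has_derivative (\<lambda>h. higher_deriv f (h # ms) w)) (at w)" for w
        by (rule has_derivative_higher_deriv[OF f]) (use len Suc.prems in auto)
      have 2: "(higher_deriv f (h # ms) has_derivative (\<lambda>k. higher_deriv f (k # h # ms) x)) (at x)" for h
        by (rule has_derivative_higher_deriv[OF f]) (use len Suc.prems in auto)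
      show "higher_deriv f (h # k # ms) x = higher_deriv f (k # h # ms) x"
        by (rule second_derivative_symmetric[OF 1 2 2])
    qed
    also have "\<dots> = higher_deriv f ks"
      using IH[of "h # ms" ks'] ms len Suc.hyps(2) by (simp add: ks)
    finally show ?thesis .
  qed
qed simp

lemma sym_form_higher_deriv:
  assumes f: "times_differentiable p f" and "n \<le> p"
  shows "sym_form n (\<lambda>hs. higher_deriv f hs x)"
  unfolding sym_form_def
proof (intro conjI allI impI)
  fix hs :: "'a list" assume "Suc (length hs) = n"
  then show "linear (\<lambda>h. higher_deriv f (h # hs) x)"
    using assms has_derivative_linear[OF has_derivative_higher_deriv[OF f, of hs x]] by simp
qed (use higher_deriv_perm[OF f] assms in metis)

text \<open>Expanding the first slot in a basis yields a sum of products for the product rule and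
  the induction hypothesis; symmetry merges the resulting terms. For n = 0 the truncated n - 1 is
  harmless, since the factor n vanishes.\<close>

lemma has_derivative_sym_form_replicate:
  assumes "sym_form n F"
  shows "((\<lambda>z. F (replicate n (z - y))) has_derivative
           (\<lambda>u. real n * F (u # replicate (n - 1) (z - y)))) (at z)"
  using assms
proof (induction n arbitrary: F)
  case (Suc n)
  note F = Suc.prems
  define w where "w = z - y"
  have "F (replicate (Suc n) (z - y)) = (\<Sum>b\<in>Basis. ((z - y) \<bullet> b) * F (b # replicate n (z - y)))" for z
    using sym_form_euclidean_expansion[OF F, of "replicate n (z - y)" "z - y"] by simp
  moreover have "((\<lambda>z. \<Sum>b\<in>Basis. ((z - y) \<bullet> b) * F (b # replicate n (z - y))) has_derivative
      (\<lambda>u. \<Sum>b\<in>Basis. (w \<bullet> b) * (real n * F (b # u # replicate (n - 1) w)) + (u \<bullet> b) * F (b # replicate n w))) (at z)"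
    unfolding w_def
    by (intro has_derivative_sum has_derivative_mult Suc.IH[OF sym_form_Cons[OF F]])
       (auto intro!: derivative_eq_intros)
  moreover have "(\<Sum>b\<in>Basis. (w \<bullet> b) * (real n * F (b # u # replicate (n - 1) w)) + (u \<bullet> b) * F (b # replicate n w))
      = real (Suc n) * F (u # replicate n w)" for u
  proof (cases n)
    case 0
    then show ?thesis using sym_form_euclidean_expansion[OF F, of "[]" u] by simp
  next
    case (Suc k)
    have "(\<Sum>b\<in>Basis. (w \<bullet> b) * (real n * F (b # u # replicate k w))) = real n * F (w # u # replicate k w)"
      by (subst sym_form_euclidean_expansion[OF F]) (simp_all add: Suc sum_distrib_left mult_ac)
    moreover have "F (w # u # replicate k w) = F (u # replicate n w)"
      by (rule sym_form_perm[OF F]) (simp_all add: Suc)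
    moreover have "F (u # replicate n w) = (\<Sum>b\<in>Basis. (u \<bullet> b) * F (b # replicate n w))"
      by (rule sym_form_euclidean_expansion[OF F]) simp
    ultimately show ?thesis by (simp add: Suc sum.distrib distrib_right)
  qed
  ultimately show ?case by (simp add: w_def)
qed simp

section \<open>Taylor models and the error of their gradients\<close>

lemma has_derivative_taylor_model:
  assumes f: "times_differentiable p f"
  shows "(taylor_model f p y has_derivative
           (\<lambda>u. \<Sum>m<p. higher_deriv f (u # replicate m (z - y)) y / fact m)) (at z)"
proof -
  have "((\<lambda>z. f y + (\<Sum>i=1..p. 1 / fact i * higher_deriv f (replicate i (z - y)) y)) has_derivative
      (\<lambda>u. 0 + (\<Sum>i=1..p. 1 / fact i * (real i * higher_deriv f (u # replicate (i - 1) (z - y)) y)))) (at z)"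
    by (intro has_derivative_add has_derivative_const has_derivative_sum has_derivative_mult_right
        has_derivative_sym_form_replicate sym_form_higher_deriv[OF f]) auto
  moreover have "(\<Sum>i=1..p. 1 / fact i * (real i * higher_deriv f (u # replicate (i - 1) (z - y)) y))
      = (\<Sum>m<p. higher_deriv f (u # replicate m (z - y)) y / fact m)" for u
    by (rule sum.reindex_bij_witness[of _ Suc "\<lambda>i. i - 1"])
       (auto simp: fact_reduce field_simps simp del: higher_deriv.simps)
  ultimately show ?thesis
    by (simp add: taylor_model_def[abs_def] del: higher_deriv.simps)
qed

lemma higher_deriv_line:
  assumes f: "times_differentiable p f" "length hs < p"
  shows "((\<lambda>s. higher_deriv f hs (y + s *\<^sub>R h)) has_real_derivative higher_deriv f (h # hs) (y + s *\<^sub>R h)) (at s)"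
proof -
  have "((\<lambda>s. higher_deriv f hs (y + s *\<^sub>R h)) has_derivative
      (\<lambda>t. higher_deriv f ((t *\<^sub>R h) # hs) (y + s *\<^sub>R h))) (at s)"
    by (rule has_derivative_compose[OF _ has_derivative_higher_deriv[OF f]])
       (auto intro!: derivative_eq_intros)
  moreover have "linear (\<lambda>h. higher_deriv f (h # hs) (y + s *\<^sub>R h'))" for h'
    by (rule has_derivative_linear[OF has_derivative_higher_deriv[OF f]])
  from linear_cmul[OF this]
  have "higher_deriv f ((t *\<^sub>R h) # hs) (y + s *\<^sub>R h) = higher_deriv f (h # hs) (y + s *\<^sub>R h) * t" for t
    by (simp add: mult.commute)
  ultimately show ?thesis
    by (simp add: has_field_derivative_def del: higher_deriv.simps)
qed

lemma blinfun_apply_gradient: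
  assumes "(f has_derivative f') (at x)"
  shows "blinfun_apply (gradient f x) = f'"
proof -
  have "frechet_derivative f (at x) = f'"
    using assms by (rule frechet_derivative_at[symmetric])
  then show ?thesis
    using has_derivative_bounded_linear[OF assms]
    by (simp add: gradient_def bounded_linear_Blinfun_apply)
qed

context spd_operator
begin

text \<open>Together with finiteness this makes \<open>real_of_ereal\<close> faithful. A basis
  vector shows that the supremum is not over the empty set, where it would be -\<infinity>.\<close>

lemma holder_const_nonneg:
  assumes f: "times_differentiable p f"
  shows "holder_const B f p \<nu> \<ge> 0"
proof -
  obtain b :: 'a where "b \<in> Basis" using nonempty_Basis by blast
  then have b: "b \<noteq> 0" by (rule nonzero_Basis)
  have "form_norm B p (\<lambda>hs. higher_deriv f hs b - higher_deriv f hs 0) \<ge> 0"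
    by (intro form_norm_nonneg sym_form_diff sym_form_higher_deriv[OF f]) auto
  then have "0 \<le> ereal (form_norm B p (\<lambda>hs. higher_deriv f hs b - higher_deriv f hs 0)
               / primal_norm B (b - 0) powr \<nu>)"
    by simp
  also have "\<dots> \<le> holder_const B f p \<nu>"
    unfolding holder_const_def by (rule SUP_upper2[of "(b, 0)"]) (use b in auto)
  finally show ?thesis .
qed

lemma form_norm_le_holder:
  assumes f: "times_differentiable p f" and fin: "holder_const B f p \<nu> < \<infinity>" and "x \<noteq> y"
  shows "form_norm B p (\<lambda>hs. higher_deriv f hs x - higher_deriv f hs y)
           \<le> real_of_ereal (holder_const B f p \<nu>) * pn (x - y) powr \<nu>"
proof -
  have "ereal (form_norm B p (\<lambda>hs. higher_deriv f hs x - higher_deriv f hs y) / pn (x - y) powr \<nu>)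
      \<le> holder_const B f p \<nu>"
    unfolding holder_const_def by (rule SUP_upper2[of "(x, y)"]) (use assms in auto)
  then have "form_norm B p (\<lambda>hs. higher_deriv f hs x - higher_deriv f hs y) / pn (x - y) powr \<nu>
      \<le> real_of_ereal (holder_const B f p \<nu>)"
    using fin holder_const_nonneg[OF f] by (cases "holder_const B f p \<nu>") auto
  moreover have "pn (x - y) powr \<nu> > 0"
    using pn_pos[of "x - y"] assms by simp
  ultimately show ?thesis by (simp add: pos_divide_le_eq)
qed

text \<open>For fixed u, the map s |-> Df(y + s h)[u] is expanded at 0 to order p - 1. The Lagrange
  remainder is D^p f at an intermediate point, the model has D^p f at y in its place, and the
  Hoelder condition bounds the difference.\<close>

lemma gradient_taylor_error:
  assumes f: "times_differentiable p f" and p: "p \<ge> 2" and \<nu>: "0 \<le> \<nu>"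
    and fin: "holder_const B f p \<nu> < \<infinity>"
  shows "dn (gradient f z - gradient (taylor_model f p y) z)
           \<le> real_of_ereal (holder_const B f p \<nu>) / fact (p - 1) * pn (z - y) powr (real p + \<nu> - 1)"
proof (rule dn_leI)
  fix u
  define h where "h = z - y"
  define H where "H = real_of_ereal (holder_const B f p \<nu>)"
  have H: "H \<ge> 0" using holder_const_nonneg[OF f] by (simp add: H_def real_of_ereal_pos)
  \<comment> \<open>The direction u is innermost, so that differentiating in s puts one more h at
    the head of the list.\<close>
  define diff where "diff m s = higher_deriv f (replicate m h @ [u]) (y + s *\<^sub>R h)" for m s
  have "\<exists>\<xi>. 0 < \<xi> \<and> \<xi> < 1 \<and>
     diff 0 1 = (\<Sum>m<p - 1. diff m 0 / fact m * 1 ^ m) + diff (p - 1) \<xi> / fact (p - 1) * 1 ^ (p - 1)"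
  proof (rule Maclaurin)
    show "\<forall>m t. m < p - 1 \<and> 0 \<le> t \<and> t \<le> 1 \<longrightarrow> DERIV (diff m) t :> diff (Suc m) t"
      unfolding diff_def using higher_deriv_line[OF f] by (auto simp del: higher_deriv.simps)
  qed (use p in auto)
  then obtain \<xi> where \<xi>: "0 < \<xi>" "\<xi> < 1"
    "diff 0 1 = (\<Sum>m<p - 1. diff m 0 / fact m) + diff (p - 1) \<xi> / fact (p - 1)"
    by auto
  have p_eq: "p = Suc (p - 1)" using p by simp
  have "(f has_derivative (\<lambda>h. higher_deriv f [h] z)) (at z)"
    using has_derivative_higher_deriv[OF f, of "[]" z] p by simp
  then have gf: "blinfun_apply (gradient f z) u = diff 0 1"
    by (simp add: blinfun_apply_gradient diff_def h_def)
  have "higher_deriv f (u # replicate m h) = higher_deriv f (replicate m h @ [u])" if "m < p" for m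
    by (rule higher_deriv_perm[OF f]) (use that in auto)
  then have gt: "blinfun_apply (gradient (taylor_model f p y) z) u = (\<Sum>m<p. diff m 0 / fact m)"
    by (simp add: blinfun_apply_gradient[OF has_derivative_taylor_model[OF f]] diff_def h_def
        del: higher_deriv.simps)
  also have "\<dots> = (\<Sum>m<p - 1. diff m 0 / fact m) + diff (p - 1) 0 / fact (p - 1)"
    by (subst p_eq) simp
  finally have err: "blinfun_apply (gradient f z - gradient (taylor_model f p y) z) u
      = (diff (p - 1) \<xi> - diff (p - 1) 0) / fact (p - 1)"
    by (simp add: blinfun.bilinear_simps gf \<xi>(3) diff_divide_distrib)
  define F where "F hs = higher_deriv f hs (y + \<xi> *\<^sub>R h) - higher_deriv f hs y" for hs
  have F: "sym_form (Suc (p - 1)) F"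
    unfolding F_def using p by (intro sym_form_diff sym_form_higher_deriv[OF f]) auto
  have "\<bar>diff (p - 1) \<xi> - diff (p - 1) 0\<bar> = \<bar>F (u # replicate (p - 1) h)\<bar>"
    using sym_form_perm[OF F, of "replicate (p - 1) h @ [u]" "u # replicate (p - 1) h"]
    by (simp add: F_def diff_def del: higher_deriv.simps)
  also have "\<dots> \<le> H * pn h powr (real p + \<nu> - 1) * pn u"
  proof (cases "h = 0")
    case True
    then have "F hs = 0" for hs by (simp add: F_def)
    then show ?thesis using H pn_nonneg by simp
  next
    case False
    have "\<bar>F (u # replicate (p - 1) h)\<bar> \<le> form_norm B p F * pn u * pn h ^ (p - 1)"
      using sym_form_le_form_norm[OF F, of u h] p by simp
    also have "form_norm B p F \<le> H * pn (\<xi> *\<^sub>R h) powr \<nu>"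
      using form_norm_le_holder[OF f fin, of "y + \<xi> *\<^sub>R h" y] False \<xi> by (simp add: F_def[abs_def] H_def)
    also have "pn (\<xi> *\<^sub>R h) powr \<nu> \<le> pn h powr \<nu>"
      using \<xi> pn_nonneg[of h] \<nu> by (intro powr_mono2) (auto simp: pn_scaleR mult_left_le_one_le)
    also have "pn h ^ (p - 1) = pn h powr (real p - 1)"
      using pn_pos[OF False] p by (simp add: powr_realpow[symmetric] of_nat_diff)
    finally have "\<bar>F (u # replicate (p - 1) h)\<bar> \<le> H * pn h powr \<nu> * pn u * pn h powr (real p - 1)"
      using H pn_nonneg by (simp add: mult_right_mono mult_left_mono)
    also have "\<dots> = H * (pn h powr (real p - 1) * pn h powr \<nu>) * pn u"
      by (simp add: mult_ac)
    also have "pn h powr (real p - 1) * pn h powr \<nu> = pn h powr (real p + \<nu> - 1)"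
      by (simp add: powr_add[symmetric] algebra_simps)
    finally show ?thesis .
  qed
  finally show "\<bar>blinfun_apply (gradient f z - gradient (taylor_model f p y) z) u\<bar>
      \<le> real_of_ereal (holder_const B f p \<nu>) / fact (p - 1) * pn (z - y) powr (real p + \<nu> - 1) * pn u"
    unfolding err by (simp add: h_def H_def abs_divide divide_right_mono)
qed

end

section \<open>Acceptance of trial points\<close>

lemma convex_on_above_gradient:
  fixes f :: "'a::euclidean_space \<Rightarrow> real"
  assumes f: "convex_on UNIV f" and d: "f differentiable (at z)"
  shows "f z + blinfun_apply (gradient f z) (w - z) \<le> f w"
proof -
  define \<phi> where "\<phi> s = f (z + s *\<^sub>R (w - z))" for s :: real
  obtain f' where f': "(f has_derivative f') (at z)" using d by (auto simp: differentiable_def)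
  have conv: "convex_on UNIV \<phi>"
  proof (rule convex_onI)
    fix t a b :: real assume t: "0 < t" "t < 1"
    have "z + ((1 - t) *\<^sub>R a + t *\<^sub>R b) *\<^sub>R (w - z)
        = (1 - t) *\<^sub>R (z + a *\<^sub>R (w - z)) + t *\<^sub>R (z + b *\<^sub>R (w - z))"
      by (simp add: algebra_simps)
    then show "\<phi> ((1 - t) *\<^sub>R a + t *\<^sub>R b) \<le> (1 - t) * \<phi> a + t * \<phi> b"
      using convex_onD[OF f, of t] t by (simp add: \<phi>_def)
  qed simp
  have "(\<phi> has_derivative (\<lambda>s. f' (s *\<^sub>R (w - z)))) (at 0)"
    unfolding \<phi>_def
    by (rule has_derivative_compose[of _ _ _ _ f]) (use f' in \<open>auto intro!: derivative_eq_intros\<close>)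
  moreover have "f' (s *\<^sub>R (w - z)) = f' (w - z) * s" for s
    using linear_cmul[OF has_derivative_linear[OF f']] by simp
  ultimately have "(\<phi> has_field_derivative f' (w - z)) (at 0)"
    by (simp add: has_field_derivative_def)
  from convex_on_imp_above_tangent[OF conv, of 0 1 "f' (w - z)"] this
  have "f' (w - z) * (1 - 0) \<le> \<phi> 1 - \<phi> 0" by simp
  then show ?thesis by (simp add: blinfun_apply_gradient[OF f'] \<phi>_def)
qed

text \<open>Serves the centre z = y in \<open>has_derivative_pn_powr\<close>, since the chain rule
  through \<open>powr\<close> is applied at a positive base.\<close>

lemma has_derivative_zero_by_domination:
  fixes \<phi> \<psi> :: "'a::real_normed_vector \<Rightarrow> real"
  assumes "(\<psi> has_derivative (\<lambda>_. 0)) (at y)" "\<psi> y = 0" "\<phi> y = 0"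
    and le: "\<forall>\<^sub>F w in at y. \<bar>\<phi> w\<bar> \<le> \<psi> w"
  shows "(\<phi> has_derivative (\<lambda>_. 0)) (at y)"
proof -
  have "((\<lambda>w. norm (\<psi> w) / norm (w - y)) \<longlongrightarrow> 0) (at y)"
    using assms by (simp add: has_derivative_iff_norm)
  moreover have "\<forall>\<^sub>F w in at y. norm (norm (\<phi> w) / norm (w - y)) \<le> norm (\<psi> w) / norm (w - y)"
    using le by eventually_elim (auto simp: divide_right_mono)
  ultimately have "((\<lambda>w. norm (\<phi> w) / norm (w - y)) \<longlongrightarrow> 0) (at y)"
    by (rule Lim_null_comparison[rotated])
  then show ?thesis using assms by (simp add: has_derivative_iff_norm)
qed

text \<open>Weighted AM-GM for \<tau>^2 and 1 with weights (1 + s)/2 and (1 - s)/2.\<close>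

lemma powr_le_quadratic:
  fixes \<tau> s :: real
  assumes "0 \<le> \<tau>" "0 \<le> s" "s \<le> 1"
  shows "\<tau> powr (1 + s) \<le> (1 + s) / 2 * \<tau>\<^sup>2 + (1 - s) / 2"
proof (cases "\<tau> = 0")
  case False
  have "(\<tau>\<^sup>2) powr ((1 + s) / 2) * 1 powr ((1 - s) / 2) \<le> (1 + s) / 2 * \<tau>\<^sup>2 + (1 - s) / 2 * 1"
    by (rule Youngs_inequality_0) (use assms False in \<open>auto simp: field_simps\<close>)
  moreover have "\<tau>\<^sup>2 = \<tau> powr 2" using assms False by simp
  then have "(\<tau>\<^sup>2) powr ((1 + s) / 2) = \<tau> powr (1 + s)"
    by (simp add: powr_powr add_divide_distrib)
  ultimately show ?thesis by simp
qed (use assms in simp)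

section \<open>Gradient of the regularised model and the acceptance test\<close>

context spd_operator
begin

text \<open>Away from the centre this is the chain rule for (|w - y|^2)^(q/2). At the centre, q >= 2
  lets the squared norm dominate the power wherever |w - y| < 1.\<close>

lemma has_derivative_pn_powr:
  assumes q: "q \<ge> 2"
  shows "((\<lambda>w. pn (w - y) powr q) has_derivative (\<lambda>h. q * pn (z - y) powr (q - 2) * ip (z - y) h)) (at z)"
proof -
  have bl: "bounded_linear B" using linear_B by (rule linear_conv_bounded_linear[THEN iffD1])
  have sq: "((\<lambda>w. ip (w - y) (w - y)) has_derivative (\<lambda>h. 2 * ip (z - y) h)) (at z)" for z
  proof -
    have "((\<lambda>w. ip (w - y) (w - y)) has_derivative (\<lambda>h. ip (z - y) h + ip h (z - y))) (at z)"
      by (rule blinfun.FDERIV[OF bounded_linear.has_derivative[OF bl]])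
         (auto intro!: derivative_eq_intros)
    then show ?thesis by (simp add: ip_commute[of _ "z - y"])
  qed
  have pn_eq: "pn w powr q = (ip w w) powr (q / 2)" for w
    by (simp add: pn_square[symmetric] powr_half_sqrt_powr pn_nonneg powr_powr flip: powr_numeral)
  show ?thesis
  proof (cases "z = y")
    case True
    have "((\<lambda>w. pn (w - y) powr q) has_derivative (\<lambda>_. 0)) (at y)"
    proof (rule has_derivative_zero_by_domination)
      show "((\<lambda>w. ip (w - y) (w - y)) has_derivative (\<lambda>_. 0)) (at y)"
        using sq[of y] by (simp add: ip_simps)
      have "isCont (\<lambda>w. pn (w - y)) y"
        using continuous_on_pn[of UNIV "\<lambda>w. w - y"] by (auto simp: continuous_on_eq_continuous_at intro!: continuous_intros)
      then have "((\<lambda>w. pn (w - y)) \<longlongrightarrow> 0) (at y)" by (simp add: isCont_def)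
      then have "\<forall>\<^sub>F w in at y. pn (w - y) < 1" by (rule order_tendstoD) simp
      then show "\<forall>\<^sub>F w in at y. \<bar>pn (w - y) powr q\<bar> \<le> ip (w - y) (w - y)"
      proof eventually_elim
        case (elim w)
        show ?case
        proof (cases "w = y")
          case False
          then have "pn (w - y) powr q \<le> pn (w - y) powr 2"
            using elim pn_pos[of "w - y"] q by (intro powr_mono') auto
          then show ?thesis using False pn_pos[of "w - y"] by (simp add: pn_square)
        qed (simp add: ip_simps)
      qed
    qed (simp_all add: ip_simps)
    then show ?thesis using True by (simp add: ip_simps)
  next
    case False
    then have pos: "ip (z - y) (z - y) > 0" by (intro ip_pos) simp
    have "((\<lambda>w. ip (w - y) (w - y) powr (q / 2)) has_derivative
        (\<lambda>h. (q / 2 * ip (z - y) (z - y) powr (q / 2 - 1)) * (2 * ip (z - y) h))) (at z)"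
      by (rule has_derivative_compose[OF sq has_real_derivative_powr[OF pos, unfolded has_field_derivative_def]])
    moreover have "ip (z - y) (z - y) powr (q / 2 - 1) = pn (z - y) powr (q - 2)"
      using pn_pos[of "z - y"] False
      by (simp add: pn_square[symmetric] powr_powr algebra_simps flip: powr_numeral)
    ultimately show ?thesis
      by (simp add: pn_eq mult_ac)
  qed
qed

lemma gradient_reg_model:
  assumes f: "times_differentiable p f" and q: "real p + \<alpha> \<ge> 2"
  shows "gradient (reg_model B f p \<alpha> M y) z = gradient (taylor_model f p y) z +
     (M * (real p + \<alpha>) / fact p * pn (z - y) powr (real p + \<alpha> - 2)) *\<^sub>R B (z - y)"
proof (rule blinfun_eqI)
  fix u
  have "(reg_model B f p \<alpha> M y has_derivative
      (\<lambda>u. (\<Sum>m<p. higher_deriv f (u # replicate m (z - y)) y / fact m) +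
        M / fact p * ((real p + \<alpha>) * pn (z - y) powr (real p + \<alpha> - 2) * ip (z - y) u))) (at z)"
    unfolding reg_model_def[abs_def]
    by (intro has_derivative_add has_derivative_taylor_model[OF f] has_derivative_mult_right
        has_derivative_pn_powr q)
  from blinfun_apply_gradient[OF this] blinfun_apply_gradient[OF has_derivative_taylor_model[OF f]]
  show "blinfun_apply (gradient (reg_model B f p \<alpha> M y) z) u = blinfun_apply (gradient (taylor_model f p y) z +
     (M * (real p + \<alpha>) / fact p * pn (z - y) powr (real p + \<alpha> - 2)) *\<^sub>R B (z - y)) u"
    by (simp add: blinfun.bilinear_simps mult_ac)
qed

text \<open>The exponent \<nu> of the Taylor error and the exponent \<alpha> of the regulariser stay
  separate, because \<alpha> = 1 when \<nu> is unknown.\<close>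

lemma inexact_step_gradient_bound:
  assumes f: "times_differentiable p f" and p: "p \<ge> 2" and "0 \<le> \<nu>" "0 \<le> \<alpha>"
    and fin: "holder_const B f p \<nu> < \<infinity>"
    and step: "inexact_step B f p \<alpha> \<theta> M y z"
  shows "dn (gradient f z + (M * (real p + \<alpha>) / fact p * pn (z - y) powr (real p + \<alpha> - 2)) *\<^sub>R B (z - y))
    \<le> real_of_ereal (holder_const B f p \<nu>) / fact (p - 1) * pn (z - y) powr (real p + \<nu> - 1)
      + \<theta> * pn (z - y) powr (real p + \<alpha> - 1)"
proof -
  have q: "real p + \<alpha> \<ge> 2" using p assms by linarith
  have eq: "gradient f z + (M * (real p + \<alpha>) / fact p * pn (z - y) powr (real p + \<alpha> - 2)) *\<^sub>R B (z - y)
      = (gradient f z - gradient (taylor_model f p y) z) + gradient (reg_model B f p \<alpha> M y) z"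
    by (simp add: gradient_reg_model[OF f q])
  have "dn (gradient f z + (M * (real p + \<alpha>) / fact p * pn (z - y) powr (real p + \<alpha> - 2)) *\<^sub>R B (z - y))
      \<le> dn (gradient f z - gradient (taylor_model f p y) z) + dn (gradient (reg_model B f p \<alpha> M y) z)"
    unfolding eq by (rule dn_triangle)
  also have "\<dots> \<le> real_of_ereal (holder_const B f p \<nu>) / fact (p - 1) * pn (z - y) powr (real p + \<nu> - 1)
      + \<theta> * pn (z - y) powr (real p + \<alpha> - 1)"
    using gradient_taylor_error[OF f p \<open>0 \<le> \<nu>\<close> fin] step
    by (intro add_mono) (auto simp: inexact_step_def)
  finally show ?thesis .
qed

(* With r the norm of u and R = r^(q-1), squaring the hypothesis bounds -g(u) from below by
   m R r (tau^2 + kappa^2 - eta^2) / (2 kappa), where tau is the dual norm of g divided by m R;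
   with s = 1/(q-1), the power tau^(1+s) is at most quadratic by Young's inequality. *)
lemma gradient_progress:
  fixes g :: "'a \<Rightarrow>\<^sub>L real"
  assumes u: "u \<noteq> 0" and q: "q \<ge> 2" and m: "m > 0" and \<kappa>: "1 \<le> \<kappa>" "\<kappa> \<le> 3 / 2"
    and \<eta>: "0 \<le> \<eta>" "\<eta>\<^sup>2 \<le> (3 + 1 / (q - 1)) / 4"
    and err: "dn (g + (\<kappa> * m * pn u powr (q - 2)) *\<^sub>R B u) \<le> \<eta> * m * pn u powr (q - 1)"
  shows "1 / 4 * (1 / m) powr (1 / (q - 1)) * dn g powr (q / (q - 1)) \<le> - blinfun_apply g u"
proof -
  define s where "s = 1 / (q - 1)"
  define r where "r = pn u"
  define R where "R = r powr (q - 1)"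
  define \<tau> where "\<tau> = dn g / (m * R)"
  have s: "0 \<le> s" "s \<le> 1" using q by (simp_all add: s_def)
  have r: "r > 0" using u by (simp add: r_def pn_pos)
  have R: "R > 0" using r by (simp add: R_def)
  have \<tau>: "\<tau> \<ge> 0" "dn g = m * R * \<tau>" using m R dn_nonneg[of g] by (simp_all add: \<tau>_def)
  have rR: "r powr (q - 2) = R / r"
    using r powr_diff[of r "q - 1" 1] by (simp add: R_def)
  have "(dn (g + (\<kappa> * m * (R / r)) *\<^sub>R B u))\<^sup>2 \<le> (\<eta> * m * R)\<^sup>2"
    using err dn_nonneg by (intro power_mono) (simp_all flip: rR r_def R_def)
  then have "(m * R * \<tau>)\<^sup>2 + 2 * (\<kappa> * m * (R / r)) * blinfun_apply g u + (\<kappa> * m * R)\<^sup>2 \<le> (\<eta> * m * R)\<^sup>2"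
    using r unfolding dn_square_add_B by (simp add: \<tau>(2) power_mult_distrib power_divide flip: r_def)
  then have "(m * R)\<^sup>2 * (\<tau>\<^sup>2 + \<kappa>\<^sup>2 - \<eta>\<^sup>2) \<le> 2 * (\<kappa> * m * (R / r)) * (- blinfun_apply g u)"
    by (simp add: power_mult_distrib algebra_simps)
  also have "\<dots> = (m * R) * (2 * \<kappa> * (- blinfun_apply g u) / r)"
    by simp
  finally have "(m * R) * (m * R * (\<tau>\<^sup>2 + \<kappa>\<^sup>2 - \<eta>\<^sup>2)) \<le> (m * R) * (2 * \<kappa> * (- blinfun_apply g u) / r)"
    by (simp only: power2_eq_square[of "m * R"] mult.assoc)
  then have "m * R * (\<tau>\<^sup>2 + \<kappa>\<^sup>2 - \<eta>\<^sup>2) \<le> 2 * \<kappa> * (- blinfun_apply g u) / r"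
    using m R by (subst (asm) mult_le_cancel_left_pos) auto
  then have "m * R * (\<tau>\<^sup>2 + \<kappa>\<^sup>2 - \<eta>\<^sup>2) * r \<le> 2 * \<kappa> * (- blinfun_apply g u)"
    by (simp only: pos_le_divide_eq[OF r])
  then have 1: "m * R * r * (\<tau>\<^sup>2 + \<kappa>\<^sup>2 - \<eta>\<^sup>2) \<le> 2 * \<kappa> * (- blinfun_apply g u)"
    by (simp add: mult_ac)
  have "\<kappa> * (1 + s) \<le> 3"
    using mult_mono[of \<kappa> "3/2" "1 + s" 2] \<kappa> s by simp
  then have quadratic: "\<kappa> * (1 + s) * \<tau>\<^sup>2 \<le> 4 * \<tau>\<^sup>2"
    by (intro mult_right_mono) auto
  \<comment> \<open>The product equals 4 \<kappa>^2 - \<kappa> (1 - s) - (3 + s); the hypothesis on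
    \<eta> is exactly what the case \<kappa> = 1 demands.\<close>
  have "0 \<le> (\<kappa> - 1) * (4 * \<kappa> + 3 + s)"
    using \<kappa> s by (intro mult_nonneg_nonneg) auto
  then have const: "\<kappa> * (1 - s) \<le> 4 * (\<kappa>\<^sup>2 - \<eta>\<^sup>2)"
    using \<eta>(2) by (simp add: s_def[symmetric] power2_eq_square algebra_simps)
  have "\<kappa> * \<tau> powr (1 + s) \<le> \<kappa> * ((1 + s) / 2 * \<tau>\<^sup>2 + (1 - s) / 2)"
    using powr_le_quadratic[OF \<tau>(1) s] \<kappa> by (intro mult_left_mono) auto
  also have "\<dots> = (\<kappa> * (1 + s) * \<tau>\<^sup>2 + \<kappa> * (1 - s)) / 2"
    by (simp add: field_simps)
  also have "\<dots> \<le> (4 * \<tau>\<^sup>2 + 4 * (\<kappa>\<^sup>2 - \<eta>\<^sup>2)) / 2"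
    by (intro divide_right_mono add_mono quadratic const) simp
  also have "\<dots> = 2 * (\<tau>\<^sup>2 + \<kappa>\<^sup>2 - \<eta>\<^sup>2)" by simp
  finally have "\<kappa> * \<tau> powr (1 + s) \<le> 2 * (\<tau>\<^sup>2 + \<kappa>\<^sup>2 - \<eta>\<^sup>2)" .
  then have "m * R * r * (\<kappa> * \<tau> powr (1 + s)) \<le> m * R * r * (2 * (\<tau>\<^sup>2 + \<kappa>\<^sup>2 - \<eta>\<^sup>2))"
    using m R r by (intro mult_left_mono) auto
  also have "\<dots> = 2 * (m * R * r * (\<tau>\<^sup>2 + \<kappa>\<^sup>2 - \<eta>\<^sup>2))" by (simp only: mult_ac)
  also have "\<dots> \<le> 2 * (2 * \<kappa> * (- blinfun_apply g u))" by (rule mult_left_mono[OF 1]) simp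
  also have "\<dots> = \<kappa> * (4 * (- blinfun_apply g u))" by simp
  finally have "\<kappa> * (m * R * r * \<tau> powr (1 + s)) \<le> \<kappa> * (4 * (- blinfun_apply g u))"
    by (simp add: mult_ac)
  then have 2: "m * R * r * \<tau> powr (1 + s) \<le> 4 * (- blinfun_apply g u)"
    using \<kappa> by (subst (asm) mult_le_cancel_left_pos) auto
  have qs: "q / (q - 1) = 1 + s" using q by (simp add: s_def field_simps)
  have "R powr s = r" using r q by (simp add: R_def s_def powr_powr)
  then have R1: "R powr (1 + s) = R * r" using R by (simp add: powr_add)
  have "(1 / m) powr s * dn g powr (1 + s) = (1 / m) powr s * (m powr (1 + s)) * R powr (1 + s) * \<tau> powr (1 + s)"
    using m R \<tau> by (simp add: powr_mult)
  also have "(1 / m) powr s * (m powr (1 + s)) = m"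
    using m by (simp add: powr_add powr_divide)
  finally have "(1 / m) powr s * dn g powr (1 + s) = m * R * r * \<tau> powr (1 + s)"
    by (simp add: R1)
  then show ?thesis using 2 by (simp add: qs flip: s_def)
qed

text \<open>Common core of both cases, which differ in \<eta>. The coefficient M q / p! of the
  regulariser's gradient is \<kappa> m with m = M / (p-1)! and \<kappa> = q/p. If z = y, the bound
  makes the gradient vanish and the test reads 0 >= 0.\<close>

lemma acceptedI:
  assumes f: "times_differentiable p f" and p: "p \<ge> 2" and \<nu>: "0 \<le> \<nu>" and \<alpha>: "0 \<le> \<alpha>" "\<alpha> \<le> 1"
    and fin: "holder_const B f p \<nu> < \<infinity>" and M: "M > 0"
    and step: "inexact_step B f p \<alpha> \<theta> M y z"
    and \<eta>: "0 \<le> \<eta>" "\<eta>\<^sup>2 \<le> (3 + 1 / (real p + \<alpha> - 1)) / 4"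
    and le: "z \<noteq> y \<Longrightarrow> real_of_ereal (holder_const B f p \<nu>) / fact (p - 1) * pn (z - y) powr (real p + \<nu> - 1)
      + \<theta> * pn (z - y) powr (real p + \<alpha> - 1) \<le> \<eta> * (M / fact (p - 1)) * pn (z - y) powr (real p + \<alpha> - 1)"
  shows "accepted B f p \<alpha> M y z"
proof -
  note bound = inexact_step_gradient_bound[OF f p \<nu> \<alpha>(1) fin step]
  show ?thesis
  proof (cases "z = y")
    case True
    then have "dn (gradient f z) \<le> 0"
      using bound linear_B by (simp add: linear_0)
    then show ?thesis
      using dn_nonneg[of "gradient f z"] True by (simp add: accepted_def)
  next
    case False
    define m where "m = M / fact (p - 1)"
    define \<kappa> where "\<kappa> = (real p + \<alpha>) / real p"
    have "fact p = real p * fact (p - 1)" using p by (simp add: fact_reduce)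
    then have c: "M * (real p + \<alpha>) / fact p = \<kappa> * m" by (simp add: \<kappa>_def m_def mult.commute)
    have "1 / 4 * (1 / m) powr (1 / ((real p + \<alpha>) - 1)) * dn (gradient f z) powr ((real p + \<alpha>) / ((real p + \<alpha>) - 1))
        \<le> - blinfun_apply (gradient f z) (z - y)"
    proof (rule gradient_progress)
      show "1 \<le> \<kappa>" "\<kappa> \<le> 3 / 2" using p \<alpha> by (simp_all add: \<kappa>_def field_simps)
      show "dn (gradient f z + (\<kappa> * m * pn (z - y) powr (real p + \<alpha> - 2)) *\<^sub>R B (z - y))
          \<le> \<eta> * m * pn (z - y) powr (real p + \<alpha> - 1)"
        using bound le[OF False] by (simp add: c m_def)
    qed (use False p \<alpha> M \<eta> in \<open>auto simp: m_def\<close>)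
    moreover have "- blinfun_apply (gradient f z) (z - y) = blinfun_apply (gradient f z) (y - z)"
      by (simp add: blinfun.bilinear_simps)
    ultimately show ?thesis by (simp add: accepted_def m_def)
  qed
qed

text \<open>Equal exponents let the Hoelder and \<theta> terms add up, with \<eta> = 1/(p + \<nu> -
  1); then \<eta>^2 <= \<eta> <= (3 + \<eta>) / 4.\<close>

lemma accepted_known:
  assumes f: "times_differentiable p f" and p: "p \<ge> 2" and \<nu>: "0 \<le> \<nu>" "\<nu> \<le> 1"
    and fin: "holder_const B f p \<nu> < \<infinity>" and M: "M > 0"
    and step: "inexact_step B f p \<nu> \<theta> M y z"
    and ge: "(real p + \<nu> - 1) * (real_of_ereal (holder_const B f p \<nu>) + \<theta> * fact (p - 1)) \<le> M"
  shows "accepted B f p \<nu> M y z"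
proof (rule acceptedI[OF f p \<nu>(1) \<nu> fin M step, of "1 / (real p + \<nu> - 1)"])
  let ?s = "1 / (real p + \<nu> - 1)"
  have s: "0 \<le> ?s" "?s \<le> 1" using p \<nu> by simp_all
  have "s\<^sup>2 \<le> (3 + s) / 4" if "0 \<le> s" "s \<le> 1" for s :: real
    using power_decreasing[of 1 2 s] that by simp
  then show "?s\<^sup>2 \<le> (3 + ?s) / 4" using s .
  show "0 \<le> ?s" by (rule s)
  have "real_of_ereal (holder_const B f p \<nu>) + \<theta> * fact (p - 1) \<le> ?s * M"
    using ge p \<nu> by (simp add: field_simps)
  then have "(real_of_ereal (holder_const B f p \<nu>) + \<theta> * fact (p - 1)) / fact (p - 1) \<le> ?s * M / fact (p - 1)"
    by (rule divide_right_mono) simp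
  then have "real_of_ereal (holder_const B f p \<nu>) / fact (p - 1) + \<theta> \<le> ?s * (M / fact (p - 1))"
    by (simp add: add_divide_distrib)
  then show "real_of_ereal (holder_const B f p \<nu>) / fact (p - 1) * pn (z - y) powr (real p + \<nu> - 1)
      + \<theta> * pn (z - y) powr (real p + \<nu> - 1) \<le> ?s * (M / fact (p - 1)) * pn (z - y) powr (real p + \<nu> - 1)"
    unfolding distrib_right[symmetric] by (rule mult_right_mono) simp
qed

section \<open>The level radius and unknown \<nu>\<close>

lemma level_radius_le:
  assumes "f xs + \<epsilon> \<le> f x0" "\<epsilon> \<ge> 0" "\<forall>z\<in>{z. f z \<le> f x0}. pn (z - xs) \<le> D0"
  shows "level_radius B f xs \<epsilon> \<le> D0"
  unfolding level_radius_def
proof (rule cSUP_least)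
  show "{x. f x \<le> f xs + \<epsilon>} \<noteq> {}" using assms by (auto intro!: exI[of _ xs])
qed (use assms in force)

text \<open>The point z may lie far outside the \<epsilon>-level set. Contracting it towards xs by t
  = \<epsilon> / (f z - f xs) brings it into that set by convexity, and scaling the gradient
  inequality by the same t turns f z - f xs into \<epsilon>.\<close>

lemma le_gradient_level_radius:
  assumes f: "convex_on UNIV f" "f differentiable (at z)" and min: "\<forall>z. f xs \<le> f z"
    and "f xs + \<epsilon> \<le> f x0" and \<epsilon>: "\<epsilon> > 0" "f z - f xs \<ge> \<epsilon>"
    and "\<forall>z\<in>{z. f z \<le> f x0}. pn (z - xs) \<le> D0"
  shows "\<epsilon> \<le> dn (gradient f z) * level_radius B f xs \<epsilon>"
proof -
  define t where "t = \<epsilon> / (f z - f xs)"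
  have t: "0 < t" "t \<le> 1" using \<epsilon> by (simp_all add: t_def)
  define w where "w = (1 - t) *\<^sub>R xs + t *\<^sub>R z"
  have "f w \<le> (1 - t) * f xs + t * f z"
    unfolding w_def using t by (intro convex_onD[OF f(1)]) auto
  also have "\<dots> = f xs + t * (f z - f xs)" by (simp add: algebra_simps)
  also have "\<dots> = f xs + \<epsilon>" using \<epsilon> by (simp add: t_def)
  finally have "pn (w - xs) \<le> level_radius B f xs \<epsilon>"
    unfolding level_radius_def
    by (intro cSUP_upper bdd_aboveI[of _ D0]) (use assms in force)+
  moreover have "w - xs = t *\<^sub>R (z - xs)" by (simp add: w_def algebra_simps)
  ultimately have R: "t * pn (z - xs) \<le> level_radius B f xs \<epsilon>" using t by (simp add: pn_scaleR)
  have "f z - f xs \<le> blinfun_apply (gradient f z) (z - xs)"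
    using convex_on_above_gradient[OF f, of xs] by (simp add: blinfun.bilinear_simps)
  also have "\<dots> \<le> dn (gradient f z) * pn (z - xs)" using apply_le_dn abs_le_D1 by blast
  finally have "t * (f z - f xs) \<le> t * (dn (gradient f z) * pn (z - xs))"
    using t by (intro mult_left_mono) auto
  also have "\<dots> \<le> dn (gradient f z) * level_radius B f xs \<epsilon>"
    using mult_left_mono[OF R dn_nonneg[of "gradient f z"]] by (simp add: mult_ac)
  finally show ?thesis using \<epsilon> by (simp add: t_def)
qed

(* If the Hoelder error dominated, the gradient would be too short for the level radius. *)
lemma accepted_unknown:
  assumes f: "times_differentiable p f" and p: "p \<ge> 2" and \<nu>: "0 \<le> \<nu>" "\<nu> \<le> 1"
    and fin: "holder_const B f p \<nu> < \<infinity>" and M: "M > 0" and \<theta>: "\<theta> \<ge> 0"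
    and step: "inexact_step B f p 1 \<theta> M y z"
    and \<epsilon>: "\<epsilon> > 0" and R: "R \<ge> 0" and grad: "\<epsilon> \<le> dn (gradient f z) * R"
    and ge1: "4 * \<theta> * fact (p - 1) \<le> M"
    and ge2: "(4 * real_of_ereal (holder_const B f p \<nu>)) powr (real p / (real p + \<nu> - 1))
              * (4 * R / \<epsilon>) powr ((1 - \<nu>) / (real p + \<nu> - 1)) \<le> M"
  shows "accepted B f p 1 M y z"
proof (rule acceptedI[OF f p \<nu>(1) _ _ fin M step, of "1 / 2"])
  define H where "H = real_of_ereal (holder_const B f p \<nu>)"
  define F :: real where "F = fact (p - 1)"
  define P where "P = real p + \<nu> - 1"
  define r where "r = pn (z - y)"
  have H: "H \<ge> 0" using holder_const_nonneg[OF f] by (simp add: H_def real_of_ereal_pos)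
  have F: "F \<ge> 1" by (simp add: F_def fact_ge_1)
  have P: "P \<ge> 1" using p \<nu> by (simp add: P_def)
  show "(1 / 2 :: real)\<^sup>2 \<le> (3 + 1 / (real p + 1 - 1)) / 4" by (simp add: power2_eq_square)
  assume "z \<noteq> y"
  then have r: "r > 0" by (simp add: r_def pn_pos)
  have Rpos: "R > 0" using R grad \<epsilon> by (cases "R = 0") auto
  have "H * r powr P \<le> M / 4 * r powr p"
  proof (rule ccontr)
    assume "\<not> ?thesis"
    then have big: "M * r powr p < 4 * H * r powr P" by simp
    then have Hpos: "H > 0" using M r H by (cases "H = 0") (auto simp: mult_less_0_iff)
    define c where "c = M * (real p + 1) / fact p * r powr (real p - 1)"
    have fact_p: "fact p = real p * F" using p by (simp add: fact_reduce F_def)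
    have c: "c * r * F \<le> 3 / 2 * M * r powr p"
    proof -
      have "r powr (real p - 1) * r = r powr p" using r by (simp add: powr_diff)
      then have "c * r * F = M * r powr p * ((real p + 1) / real p)"
        using p F by (simp add: c_def fact_p field_simps)
      also have "\<dots> \<le> M * r powr p * (3 / 2)"
        using p M by (intro mult_left_mono) (auto simp: field_simps)
      finally show ?thesis by simp
    qed
    have c0: "c \<ge> 0" using M by (simp add: c_def)
    have "dn (gradient f z) \<le> dn (gradient f z + c *\<^sub>R B (z - y)) + dn (- (c *\<^sub>R B (z - y)))"
      using dn_triangle[of "gradient f z + c *\<^sub>R B (z - y)" "- (c *\<^sub>R B (z - y))"] by simp
    also have "\<dots> = dn (gradient f z + c *\<^sub>R B (z - y)) + c * r"
      using c0 by (simp add: dn_minus dn_scaleR_B r_def)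
    also have "\<dots> \<le> H / F * r powr P + \<theta> * r powr p + c * r"
      using inexact_step_gradient_bound[OF f p \<nu>(1) _ fin step]
      by (simp add: H_def F_def P_def r_def c_def)
    finally have "dn (gradient f z) * F \<le> (H / F * r powr P + \<theta> * r powr p + c * r) * F"
      using F by (intro mult_right_mono) auto
    also have "\<dots> = H * r powr P + \<theta> * F * r powr p + c * r * F"
      using F by (simp add: field_simps)
    also have "\<dots> \<le> H * r powr P + M / 4 * r powr p + 3 / 2 * M * r powr p"
      using ge1 c by (intro add_mono mult_right_mono) (auto simp: F_def)
    \<comment> \<open>\<open>big\<close> trades M r^p for 4 H r^P, and 1 + 4 (1/4 + 3/2) =
      8.\<close>
    also have "\<dots> < 8 * H * r powr P" using big by simp
    finally have dF: "dn (gradient f z) * F < 8 * H * r powr P" .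
    have "dn (gradient f z) \<le> dn (gradient f z) * F"
      using F dn_nonneg[of "gradient f z"] by (simp add: mult_le_cancel_left1)
    then have "dn (gradient f z) * R < 8 * H * r powr P * R"
      using dF Rpos by simp
    \<comment> \<open>The slack from 8 to 16 matches the product of 4H and 4R/\<epsilon> in the
      threshold on M.\<close>
    then have gt1: "1 < 16 * H * R * r powr P / \<epsilon>"
      using grad \<epsilon> by (simp add: field_simps)
    have split_p: "real p = P + (1 - \<nu>)" by (simp add: P_def)
    have "M * r powr (1 - \<nu>) < 4 * H"
    proof -
      have "M * r powr (1 - \<nu>) * r powr P < 4 * H * r powr P"
        using big by (simp add: split_p powr_add mult_ac)
      then show ?thesis using r by (simp add: mult_less_cancel_right)
    qed
    then have "(M * r powr (1 - \<nu>)) powr P < (4 * H) powr P"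
      using M r P by (intro powr_less_mono2) auto
    then have lt: "M powr P * (r powr P) powr (1 - \<nu>) < (4 * H) powr P"
      using M r by (simp add: powr_mult powr_powr mult.commute)
    \<comment> \<open>Raising both bounds on M to the power P clears the fractional exponents. As p
      = P + (1 - \<nu>), what remains is a power 1 - \<nu> of a number above 1 that would have to be
      less than 1.\<close>
    have "((4 * H) powr (p / P) * (4 * R / \<epsilon>) powr ((1 - \<nu>) / P)) powr P \<le> M powr P"
      using ge2 P by (intro powr_mono2) (auto simp: H_def P_def)
    moreover have "((4 * H) powr (p / P) * (4 * R / \<epsilon>) powr ((1 - \<nu>) / P)) powr P
        = (4 * H) powr p * (4 * R / \<epsilon>) powr (1 - \<nu>)"
      using P by (simp add: powr_mult powr_powr)
    ultimately have "(4 * H) powr p * (4 * R / \<epsilon>) powr (1 - \<nu>) * (r powr P) powr (1 - \<nu>)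
        \<le> M powr P * (r powr P) powr (1 - \<nu>)"
      by (intro mult_right_mono) auto
    also note lt
    also have "(4 * H) powr p = (4 * H) powr P * (4 * H) powr (1 - \<nu>)"
      unfolding split_p by (rule powr_add)
    finally have "(4 * H) powr P * ((4 * H) powr (1 - \<nu>) * (4 * R / \<epsilon>) powr (1 - \<nu>) * (r powr P) powr (1 - \<nu>))
        < (4 * H) powr P * 1"
      by (simp add: mult_ac)
    then have "(4 * H) powr (1 - \<nu>) * (4 * R / \<epsilon>) powr (1 - \<nu>) * (r powr P) powr (1 - \<nu>) < 1"
      using Hpos by (subst (asm) mult_less_cancel_left_pos) auto
    moreover have "(4 * H) powr (1 - \<nu>) * (4 * R / \<epsilon>) powr (1 - \<nu>) * (r powr P) powr (1 - \<nu>)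
        = (16 * H * R * r powr P / \<epsilon>) powr (1 - \<nu>)"
      using Hpos Rpos \<epsilon> r by (simp add: mult.assoc flip: powr_mult)
    ultimately show False
      using ge_one_powr_ge_zero[of "16 * H * R * r powr P / \<epsilon>" "1 - \<nu>"] gt1 \<nu> by simp
  qed
  moreover have "\<theta> * F * r powr p \<le> M / 4 * r powr p"
    using ge1 by (intro mult_right_mono) (auto simp: F_def)
  ultimately have "(H * r powr P + \<theta> * F * r powr p) / F \<le> (M / 2 * r powr p) / F"
    using F by (intro divide_right_mono) auto
  then show "real_of_ereal (holder_const B f p \<nu>) / fact (p - 1) * pn (z - y) powr (real p + \<nu> - 1)
      + \<theta> * pn (z - y) powr (real p + 1 - 1) \<le> 1 / 2 * (M / fact (p - 1)) * pn (z - y) powr (real p + 1 - 1)"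
    using F unfolding H_def[symmetric] F_def[symmetric] P_def[symmetric] r_def[symmetric]
    by (simp add: add_divide_distrib)
qed simp_all

end

section \<open>Estimating sequences\<close>

lemma powr_superadditive:
  fixes x y t :: real
  assumes "0 \<le> x" "0 \<le> y" "1 \<le> t"
  shows "x powr t + y powr t \<le> (x + y) powr t"
proof (cases "x + y = 0")
  case False
  then have pos: "x + y > 0" using assms by simp
  have le: "w powr t \<le> (x + y) powr t * (w / (x + y))" if w: "0 \<le> w" "w \<le> x + y" for w
  proof -
    have "(w / (x + y)) powr t \<le> (w / (x + y)) powr 1"
      using w pos assms by (intro powr_mono') auto
    then have "(x + y) powr t * (w / (x + y)) powr t \<le> (x + y) powr t * (w / (x + y))"
      using w pos by (intro mult_left_mono) auto
    then show ?thesis using w pos by (simp add: powr_divide)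
  qed
  have "x powr t + y powr t \<le> (x + y) powr t * (x / (x + y)) + (x + y) powr t * (y / (x + y))"
    using assms by (intro add_mono le) auto
  also have "\<dots> = (x + y) powr t"
    unfolding distrib_left[symmetric] add_divide_distrib[symmetric] using pos by simp
  finally show ?thesis .
next
  case True
  then have "x = 0" "y = 0" using assms by auto
  then show ?thesis by simp
qed

lemma powr_midpoint:
  fixes x y t :: real
  assumes "0 \<le> x" "0 \<le> y" "1 \<le> t"
  shows "((x + y) / 2) powr t \<le> (x powr t + y powr t) / 2"
proof -
  have half: "(w / 2) powr t \<le> w powr t / 2" if "0 \<le> w" for w :: real
    using powr_superadditive[of "w / 2" "w / 2" t] that assms by simp
  show ?thesis
  proof (cases "x = 0 \<or> y = 0")
    case False
    then have "((1 - 1 / 2) *\<^sub>R x + (1 / 2) *\<^sub>R y) powr t \<le> (1 - 1 / 2) * x powr t + 1 / 2 * y powr t"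
      using assms by (intro convex_onD[OF powr_convex]) auto
    then show ?thesis by (simp add: field_simps)
  qed (use half assms in auto)
qed

lemma two_powr_le_one_plus:
  fixes s :: real
  assumes "0 \<le> s" "s \<le> 1"
  shows "2 powr s \<le> 1 + s"
  using Youngs_inequality_0[of s "1 - s" 2 1] assms by simp

text \<open>With X = A + a, concavity of the q-th root gives A^(1/q) <= X^(1/q) (1 - a/(q X)), and
  the hypothesis bounds X^(1/q) a/X below by c^(1/q). Each iteration thus adds a fixed amount to
  A_t^(1/q).\<close>

lemma root_increment:
  fixes a A c q :: real
  assumes q: "q \<ge> 1" and a: "a > 0" and A: "A \<ge> 0" and c: "c > 0"
    and le: "c * (A + a) powr (q - 1) \<le> a powr q"
  shows "A powr (1 / q) + c powr (1 / q) / q \<le> (A + a) powr (1 / q)"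
proof -
  define X where "X = A + a"
  have X: "X > 0" using a A by (simp add: X_def)
  have 1: "A powr (1 / q) \<le> X powr (1 / q) - X powr (1 / q) * (a / X) / q"
  proof (cases "A = 0")
    case True
    then show ?thesis using q a by (simp add: X_def field_simps)
  next
    case False
    have AX: "A / X = 1 - a / X" using X by (simp add: X_def field_simps)
    have "(A / X) powr (1 / q) * 1 powr (1 - 1 / q) \<le> 1 / q * (A / X) + (1 - 1 / q) * 1"
      using False A X q by (intro Youngs_inequality_0) auto
    also have "\<dots> = 1 - (a / X) / q"
      by (simp add: AX right_diff_distrib)
    finally have "X powr (1 / q) * (A / X) powr (1 / q) \<le> X powr (1 / q) * (1 - (a / X) / q)"
      by (intro mult_left_mono) auto
    then show ?thesis using A X by (simp add: powr_divide right_diff_distrib)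
  qed
  have "(c * X powr (q - 1)) powr (1 / q) \<le> (a powr q) powr (1 / q)"
    using le q c by (intro powr_mono2) (auto simp: X_def)
  then have "c powr (1 / q) * X powr (1 - 1 / q) \<le> a"
    using a q c X by (simp add: powr_mult powr_powr diff_divide_distrib)
  then have "c powr (1 / q) * X powr (1 - 1 / q) * X powr (1 / q - 1) \<le> a * X powr (1 / q - 1)"
    by (intro mult_right_mono) auto
  also have "c powr (1 / q) * X powr (1 - 1 / q) * X powr (1 / q - 1) = c powr (1 / q)"
    using X by (simp add: mult.assoc flip: powr_add)
  also have "a * X powr (1 / q - 1) = X powr (1 / q) * (a / X)"
    using X by (simp add: powr_diff)
  finally have "c powr (1 / q) \<le> X powr (1 / q) * (a / X)" .
  then have "c powr (1 / q) / q \<le> X powr (1 / q) * (a / X) / q"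
    using q by (intro divide_right_mono) auto
  then show ?thesis using 1 by (simp add: X_def)
qed

context spd_operator
begin

text \<open>The parallelogram law for squared norms, followed by superadditivity and convexity of
  the power q/2 >= 1.\<close>

lemma clarkson:
  assumes q: "q \<ge> 2"
  shows "pn ((1 / 2) *\<^sub>R (a + b)) powr q + pn ((1 / 2) *\<^sub>R (a - b)) powr q \<le> (pn a powr q + pn b powr q) / 2"
proof -
  have pn_eq: "pn w powr q = ((pn w)\<^sup>2) powr (q / 2)" for w
    using pn_nonneg[of w] by (cases "w = 0") (simp_all add: powr_powr flip: powr_numeral)
  have par: "(pn ((1 / 2) *\<^sub>R (a + b)))\<^sup>2 + (pn ((1 / 2) *\<^sub>R (a - b)))\<^sup>2 = ((pn a)\<^sup>2 + (pn b)\<^sup>2) / 2"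
    by (simp add: pn_square ip_simps ip_commute[of b a] field_simps)
  have "pn ((1 / 2) *\<^sub>R (a + b)) powr q + pn ((1 / 2) *\<^sub>R (a - b)) powr q
      \<le> (((pn a)\<^sup>2 + (pn b)\<^sup>2) / 2) powr (q / 2)"
    unfolding pn_eq par[symmetric] using q by (intro powr_superadditive) auto
  also have "\<dots> \<le> (((pn a)\<^sup>2) powr (q / 2) + ((pn b)\<^sup>2) powr (q / 2)) / 2"
    using q by (intro powr_midpoint) auto
  finally show ?thesis by (simp add: pn_eq)
qed

text \<open>At the midpoint w of z and v, Clarkson's inequality gains 2^(-q)/q |z - v|^q over the
  average of \<psi> z and \<psi> v, yet \<psi> w >= \<psi> v; doubling yields the factor 2^(1-q)/q.
  The affine part enters through its midpoint identity.\<close>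

lemma prox_growth:
  assumes q: "q \<ge> 2" and \<psi>: "\<And>z. \<psi> z = pn (z - x0) powr q / q + l z"
    and l: "\<And>a b. l ((1 / 2) *\<^sub>R (a + b)) = (l a + l b) / 2"
    and v: "\<And>z. \<psi> v \<le> \<psi> z"
  shows "\<psi> v + 2 powr (1 - q) / q * pn (z - v) powr q \<le> \<psi> z"
proof -
  define w where "w = (1 / 2) *\<^sub>R (z + v)"
  have w: "w - x0 = (1 / 2) *\<^sub>R ((z - x0) + (v - x0))"
    by (simp add: w_def algebra_simps flip: scaleR_2)
  have "pn (w - x0) powr q + pn ((1 / 2) *\<^sub>R (z - v)) powr q \<le> (pn (z - x0) powr q + pn (v - x0) powr q) / 2"
    using clarkson[OF q, of "z - x0" "v - x0"] by (simp add: w)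
  moreover have "pn ((1 / 2) *\<^sub>R (z - v)) powr q = 2 powr (- q) * pn (z - v) powr q"
    using pn_nonneg by (simp add: pn_scaleR powr_divide powr_minus_divide)
  ultimately have "pn (w - x0) powr q \<le> (pn (z - x0) powr q + pn (v - x0) powr q) / 2 - 2 powr (- q) * pn (z - v) powr q"
    by linarith
  then have le: "pn (w - x0) powr q / q \<le> ((pn (z - x0) powr q + pn (v - x0) powr q) / 2 - 2 powr (- q) * pn (z - v) powr q) / q"
    using q by (intro divide_right_mono) auto
  define W where "W = 2 powr (- q) * pn (z - v) powr q / q"
  from le have "\<psi> w \<le> (\<psi> z + \<psi> v) / 2 - W"
    by (simp add: \<psi> w_def l diff_divide_distrib add_divide_distrib W_def)
  moreover have "2 powr (1 - q) = 2 * 2 powr (- q)"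
    using powr_add[of 2 1 "- q"] by simp
  then have W: "2 powr (1 - q) / q * pn (z - v) powr q = 2 * W"
    by (simp add: W_def)
  ultimately show ?thesis unfolding W using v[of w] by (simp add: field_simps)
qed

text \<open>Young's inequality with conjugate exponents q and q/(q-1). The left side is minus A
  times the decrease promised by the acceptance test, which thereby pays for the move h from v_t to
  the next minimiser.\<close>

lemma prox_lower_bound:
  assumes q: "2 \<le> q" "q \<le> real p + 1" and pos: "m > 0" "a > 0" "A > 0"
    and a: "a powr q = 1 / 2 ^ (3 * p - 1) * (1 / m) * A powr (q - 1)"
  shows "- (A * (1 / 4 * (1 / m) powr (1 / (q - 1)) * dn g powr (q / (q - 1))))
           \<le> a * blinfun_apply g h + 2 powr (1 - q) / q * pn h powr q"
proof -
  define s where "s = 1 / (q - 1)"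
  define G where "G = dn g"
  have G: "G \<ge> 0" by (simp add: G_def dn_nonneg)
  have s: "0 < s" "s \<le> 1" using q by (simp_all add: s_def)
  \<comment> \<open>The powers of 2 are split so that b^q / q is the convexity term, while they
    cancel in d b = a G |h|.\<close>
  define b where "b = 2 powr ((1 - q) / q) * pn h"
  define d where "d = 2 powr ((q - 1) / q) * (a * G)"
  define q' where "q' = q / (q - 1)"
  have q': "q' > 1" "1 / q' + 1 / q = 1" "1 / q' = (q - 1) / q" "q' = 1 + s"
    using q by (simp_all add: q'_def s_def field_simps)
  define Y where "Y = 2 powr (1 - q) / q * pn h powr q"
  define Z where "Z = A * (1 / 4 * (1 / m) powr s * G powr q')"
  have 1: "d * b \<le> d powr q' / q' + b powr q / q"
    using q q' G pos pn_nonneg by (intro Youngs_inequality) (auto simp: d_def b_def)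
  have 2: "d * b = a * (G * pn h)"
  proof -
    have "(2::real) powr ((q - 1) / q) * 2 powr ((1 - q) / q) = 2 powr (((q - 1) + (1 - q)) / q)"
      by (simp only: add_divide_distrib powr_add)
    then have "(2::real) powr ((q - 1) / q) * 2 powr ((1 - q) / q) = 1" by simp
    then show ?thesis by (simp add: d_def b_def mult_ac)
  qed
  have 3: "b powr q / q = Y"
    using q pn_nonneg by (simp add: b_def powr_mult powr_powr Y_def)
  have 4: "d powr q' / q' \<le> Z"
  proof -
    have "a powr q' = (a powr q) powr s"
      using q by (simp add: q'_def s_def powr_powr)
    also have "\<dots> = (1 / 2 ^ (3 * p - 1)) powr s * (1 / m) powr s * (A powr (q - 1)) powr s"
      using pos by (simp add: a powr_mult powr_divide)
    also have "(A powr (q - 1)) powr s = A"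
      using pos q by (simp add: powr_powr s_def)
    also have "(1 / 2 ^ (3 * p - 1)) powr s = 2 powr (- (real (3 * p - 1) * s))"
      by (simp add: powr_divide powr_realpow[symmetric] powr_powr powr_minus_divide)
    finally have aq: "a powr q' = 2 powr (- (real (3 * p - 1) * s)) * (1 / m) powr s * A" .
    have "(2 powr ((q - 1) / q)) powr q' = 2"
      using q by (simp add: powr_powr q'_def)
    then have dq: "d powr q' = 2 * a powr q' * G powr q'"
      using pos G by (simp add: d_def powr_mult)
    \<comment> \<open>The choice of 2^(3p-1): since q - 1 <= p, its power is at most 2^(s-3) = 2^s /
      8 <= (1 + s)/8 = q'/8, and Young's factor 2/q' turns this into 1/4.\<close>
    have "3 * (q - 1) - 1 \<le> real (3 * p - 1)"
      using q by (simp add: of_nat_diff)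
    then have "(3 * (q - 1) - 1) * s \<le> real (3 * p - 1) * s"
      using s by (intro mult_right_mono) auto
    moreover have "(3 * (q - 1) - 1) * s = 3 - s"
      using q by (simp add: s_def field_simps)
    ultimately have "2 powr (- (real (3 * p - 1) * s)) \<le> 2 powr (s - 3)"
      by (intro powr_mono) auto
    also have "\<dots> = 2 powr s / 8"
      using powr_diff[of 2 s 3] by simp
    also have "\<dots> \<le> q' / 8"
      using two_powr_le_one_plus[of s] s by (simp add: q'(4))
    finally have "2 * 2 powr (- (real (3 * p - 1) * s)) / q' \<le> 1 / 4"
      using q' by (simp add: field_simps)
    then have "2 * 2 powr (- (real (3 * p - 1) * s)) / q' * ((1 / m) powr s * A * G powr q')
        \<le> 1 / 4 * ((1 / m) powr s * A * G powr q')"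
      using pos by (intro mult_right_mono) auto
    then show ?thesis by (simp add: dq aq Z_def mult_ac)
  qed
  have "- (G * pn h) \<le> blinfun_apply g h"
    using apply_le_dn[of g h] by (simp add: G_def)
  then have "a * (- (G * pn h)) \<le> a * blinfun_apply g h"
    using pos by (intro mult_left_mono) auto
  then have "- Z \<le> a * blinfun_apply g h + Y"
    using 1 2 3 4 by simp
  then show ?thesis by (simp add: G_def s_def q'_def Y_def Z_def)
qed

end

section \<open>Invariants of a run\<close>

locale aatm = spd_operator B for B :: "'a::euclidean_space \<Rightarrow> ('a \<Rightarrow>\<^sub>L real)" +
  fixes f :: "'a \<Rightarrow> real" and p T :: nat and \<alpha> \<theta> H0 :: real and x0 :: 'a
    and x v :: "nat \<Rightarrow> 'a" and A H :: "nat \<Rightarrow> real" and \<psi> :: "nat \<Rightarrow> 'a \<Rightarrow> real"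
    and it :: "nat \<Rightarrow> nat" and aa g :: "nat \<Rightarrow> nat \<Rightarrow> real" and y xp :: "nat \<Rightarrow> nat \<Rightarrow> 'a"
  assumes p: "p \<ge> 2" and \<alpha>: "0 \<le> \<alpha>" "\<alpha> \<le> 1" and H0: "H0 > 0"
    and conv: "convex_on UNIV f" and diff: "\<And>z. f differentiable (at z)"
    and run: "AATM_run B f p \<alpha> \<theta> x0 H0 T x v A H \<psi> it aa g y xp"
begin

abbreviation q :: real where "q \<equiv> real p + \<alpha>"

lemma q_ge_2: "q \<ge> 2" using p \<alpha> by linarith

lemma init: "x 0 = x0" "v 0 = x0" "A 0 = 0" "H 0 = H0" "\<psi> 0 = (\<lambda>z. 1 / q * pn (z - x0) powr q)"
  using run by (simp_all add: AATM_run_def)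

lemma trial:
  assumes "t \<le> T" "i \<le> it t"
  shows "aa t i > 0"
    "aa t i powr q = 1 / 2 ^ (3 * p - 1) * (fact (p - 1) / (2 ^ i * H t)) * (A t + aa t i) powr (q - 1)"
    "g t i = aa t i / (A t + aa t i)"
    "y t i = (1 - g t i) *\<^sub>R x t + g t i *\<^sub>R v t"
    "inexact_step B f p \<alpha> \<theta> (2 ^ i * H t) (y t i) (xp t i)"
  using run assms unfolding AATM_run_def by blast+

lemma rejected: "t \<le> T \<Longrightarrow> i < it t \<Longrightarrow> \<not> accepted B f p \<alpha> (2 ^ i * H t) (y t i) (xp t i)"
  using run unfolding AATM_run_def by blast

lemma update:
  assumes "t \<le> T"
  shows "accepted B f p \<alpha> (2 ^ it t * H t) (y t (it t)) (xp t (it t))"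
    "x (Suc t) = xp t (it t)" "A (Suc t) = A t + aa t (it t)"
    "H (Suc t) = 2 powi (int (it t) - 1) * H t"
    "\<psi> (Suc t) = (\<lambda>z. \<psi> t z + aa t (it t) *
       (f (x (Suc t)) + blinfun_apply (gradient f (x (Suc t))) (z - x (Suc t))))"
    "is_arg_min (\<psi> (Suc t)) (\<lambda>_. True) (v (Suc t))"
  using run assms unfolding AATM_run_def by blast+

text \<open>The accepted trial parameter is twice the new \<open>H\<close>, also for
  \<open>it t = 0\<close>, where the exponent in the update is -1.\<close>

lemma H_Suc: "t \<le> T \<Longrightarrow> H (Suc t) = 2 ^ it t * H t / 2"
  by (simp add: update(4) power_int_diff)

lemma H_pos: "t \<le> Suc T \<Longrightarrow> H t > 0"
  by (induction t) (simp_all add: init H0 H_Suc)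

lemma A_nonneg: "t \<le> Suc T \<Longrightarrow> A t \<ge> 0"
  by (induction t) (use trial(1) in \<open>force simp: init update(3)\<close>)+

lemma v_minimises:
  assumes "t \<le> Suc T"
  shows "\<psi> t (v t) \<le> \<psi> t z"
proof (cases t)
  case 0
  then show ?thesis using q_ge_2 by (simp add: init)
next
  case (Suc t')
  then show ?thesis using update(6)[of t'] assms by (auto simp: is_arg_min_linorder)
qed

text \<open>The accumulated linearisations are affine, in the form that \<open>prox_growth\<close>
  asks for.\<close>

lemma \<psi>_form:
  "t \<le> Suc T \<Longrightarrow> \<exists>l. (\<forall>z. \<psi> t z = pn (z - x0) powr q / q + l z) \<and>
     (\<forall>a b. l ((1 / 2) *\<^sub>R (a + b)) = (l a + l b) / 2)"
proof (induction t)
  case 0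
  show ?case by (rule exI[of _ "\<lambda>_. 0"]) (simp add: init)
next
  case (Suc t)
  then obtain l where l: "\<And>z. \<psi> t z = pn (z - x0) powr q / q + l z"
      "\<And>a b. l ((1 / 2) *\<^sub>R (a + b)) = (l a + l b) / 2"
    by auto
  define l' where "l' z = aa t (it t) * (f (x (Suc t)) + blinfun_apply (gradient f (x (Suc t))) (z - x (Suc t)))" for z
  have l': "l' ((1 / 2) *\<^sub>R (a + b)) = (l' a + l' b) / 2" for a b
    by (simp add: l'_def blinfun.bilinear_simps field_simps)
  have "l ((1 / 2) *\<^sub>R (a + b)) + l' ((1 / 2) *\<^sub>R (a + b)) = ((l a + l' a) + (l b + l' b)) / 2" for a b
    unfolding l(2) l' by (simp add: add_divide_distrib)
  moreover have "\<psi> (Suc t) z = pn (z - x0) powr q / q + (l z + l' z)" for z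
    using Suc.prems by (simp add: update(5) l(1) l'_def)
  ultimately show ?case by (intro exI[of _ "\<lambda>z. l z + l' z"]) blast
qed

text \<open>By uniform convexity, \<psi>_t at the new minimiser z exceeds its minimum by a power of
  |z - v_t|. Convexity replaces f(x_t) by the tangent at x_(t+1); the slopes at x_t and v_t then
  combine into one at y_t, where the acceptance test applies, and \<open>prox_lower_bound\<close>
  settles what depends on z - v_t.\<close>

lemma estimate_lower: "t \<le> Suc T \<Longrightarrow> A t * f (x t) \<le> \<psi> t (v t)"
proof (induction t)
  case 0
  show ?case using q_ge_2 by (simp add: init)
next
  case (Suc t)
  then have t: "t \<le> T" by simp
  define a where "a = aa t (it t)"
  define M where "M = 2 ^ it t * H t"
  define yt where "yt = y t (it t)"
  define X where "X = x (Suc t)"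
  define D where "D = blinfun_apply (gradient f X)"
  define z where "z = v (Suc t)"
  define G where "G = 1 / 4 * (1 / (M / fact (p - 1))) powr (1 / (q - 1)) * dn (gradient f X) powr (q / (q - 1))"
  note tr = trial[OF t order_refl, folded a_def M_def yt_def]
  note up = update[OF t, folded a_def M_def yt_def X_def D_def]
  have M: "M > 0" using H_pos[of t] t by (simp add: M_def)
  have A: "A t \<ge> 0" using A_nonneg[of t] t by simp
  have D_simps: "D (u + w) = D u + D w" "D (u - w) = D u - D w" "D (c *\<^sub>R u) = c * D u" for u w c
    by (simp_all add: D_def blinfun.bilinear_simps)
  obtain l where l: "\<And>z. \<psi> t z = pn (z - x0) powr q / q + l z"
      "\<And>a b. l ((1 / 2) *\<^sub>R (a + b)) = (l a + l b) / 2"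
    using \<psi>_form[of t] t by auto
  have "A t * (f X + D (x t - X)) \<le> A t * f (x t)"
    unfolding D_def using A by (intro mult_left_mono convex_on_above_gradient conv diff)
  also have "\<dots> \<le> \<psi> t (v t)" using Suc.IH t by simp
  also have "\<dots> \<le> \<psi> t z - 2 powr (1 - q) / q * pn (z - v t) powr q"
    using prox_growth[OF q_ge_2 l v_minimises[of t], of z] t by simp
  finally have 1: "A t * (f X + D (x t - X)) + 2 powr (1 - q) / q * pn (z - v t) powr q \<le> \<psi> t z" by simp
  \<comment> \<open>The purpose of \<gamma>_t: y_t averages x_t and v_t with weights A_t and
    a.\<close>
  have "A (Suc t) *\<^sub>R yt = A t *\<^sub>R x t + a *\<^sub>R v t"
  proof -
    have "A t + a \<noteq> 0" using A tr(1) by linarith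
    then have "(A t + a) * (1 - a / (A t + a)) = A t" "(A t + a) * (a / (A t + a)) = a"
      by (simp_all add: field_simps)
    then show ?thesis
      by (simp only: tr(3,4) up(3) scaleR_add_right scaleR_scaleR yt_def a_def)
  qed
  from arg_cong[OF this, of D]
  have 2: "A t * D (x t) + a * D (v t) = A (Suc t) * D yt" by (simp add: D_simps)
  have "G \<le> D (yt - X)"
    using up(1,2) by (simp add: accepted_def G_def D_def X_def yt_def M_def)
  then have "A (Suc t) * G \<le> A (Suc t) * D (yt - X)"
    using A_nonneg[OF Suc.prems] by (rule mult_left_mono)
  moreover have "- (A (Suc t) * G) \<le> a * D (z - v t) + 2 powr (1 - q) / q * pn (z - v t) powr q"
    unfolding G_def D_def
  proof (rule prox_lower_bound)
    show "a powr q = 1 / 2 ^ (3 * p - 1) * (1 / (M / fact (p - 1))) * A (Suc t) powr (q - 1)"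
      using tr(2) by (simp add: up(3))
  qed (use q_ge_2 \<alpha> M tr(1) A in \<open>auto simp: up(3)\<close>)
  moreover have "A (Suc t) * f X = A t * f X + a * f X" by (simp add: up(3) distrib_right)
  moreover have "A (Suc t) * D X = A t * D X + a * D X" by (simp add: up(3) distrib_right)
  moreover have "\<psi> (Suc t) z = \<psi> t z + a * (f X + D (z - X))"
    by (simp add: up(5) D_def)
  ultimately show ?case
    using 1 2 unfolding X_def[symmetric] z_def[symmetric]
    by (simp add: D_simps right_diff_distrib distrib_left)
qed

lemma estimate_upper: "t \<le> Suc T \<Longrightarrow> \<psi> t z \<le> A t * f z + pn (z - x0) powr q / q"
proof (induction t)
  case (Suc t)
  then have t: "t \<le> T" by simp
  have "aa t (it t) * (f (x (Suc t)) + blinfun_apply (gradient f (x (Suc t))) (z - x (Suc t)))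
      \<le> aa t (it t) * f z"
    using trial(1)[OF t order_refl] by (intro mult_left_mono convex_on_above_gradient conv diff) simp
  then show ?case using Suc by (simp add: update[OF t] distrib_right)
qed (simp add: init)

text \<open>N is any threshold that guarantees acceptance. If \<open>it t = Suc i\<close>, index i
  was rejected, so 2^i H_t < N, and 2^i H_t is exactly \<open>H (Suc t)\<close>; if
  \<open>it t = 0\<close>, the parameter is halved.\<close>

lemma regularisation_le:
  assumes "\<And>t i. t \<le> T \<Longrightarrow> i \<le> it t \<Longrightarrow> N \<le> 2 ^ i * H t \<Longrightarrow>
      accepted B f p \<alpha> (2 ^ i * H t) (y t i) (xp t i)"
  shows "t \<le> Suc T \<Longrightarrow> H t \<le> max N H0"
proof (induction t)
  case (Suc t)
  then have t: "t \<le> T" by simp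
  show ?case
  proof (cases "it t")
    case 0
    then show ?thesis using Suc H_pos[of t] by (simp add: H_Suc[OF t])
  next
    case (Suc i)
    then have "2 ^ i * H t < N"
      using assms[of t i] rejected[of t i] t by (cases "N \<le> 2 ^ i * H t") auto
    then show ?thesis by (simp add: H_Suc[OF t] Suc)
  qed
qed (simp add: init)

lemma A_growth:
  assumes N: "N > 0" "\<And>t. t \<le> Suc T \<Longrightarrow> H t \<le> N" and "t \<le> Suc T"
  shows "real t * ((fact (p - 1) / (2 ^ (3 * p) * N)) powr (1 / q) / q) \<le> A t powr (1 / q)"
  using assms(3)
proof (induction t)
  case (Suc t)
  then have t: "t \<le> T" by simp
  define c where "c = fact (p - 1) / (2 ^ (3 * p) * N)"
  define a where "a = aa t (it t)"
  note tr = trial[OF t order_refl, folded a_def]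
  have "A t powr (1 / q) + c powr (1 / q) / q \<le> (A t + a) powr (1 / q)"
  proof (rule root_increment)
    \<comment> \<open>The accepted trial parameter can reach 2 N, which turns 2^(3p-1) into
      2^(3p).\<close>
    have "2 ^ it t * H t \<le> 2 * N" using N(2)[OF Suc.prems] by (simp add: H_Suc[OF t])
    then have "fact (p - 1) / (2 * N) \<le> fact (p - 1) / (2 ^ it t * H t)"
      using H_pos[of t] t N(1) by (intro divide_left_mono) auto
    then have "1 / 2 ^ (3 * p - 1) * (fact (p - 1) / (2 * N)) \<le> 1 / 2 ^ (3 * p - 1) * (fact (p - 1) / (2 ^ it t * H t))"
      by (intro mult_left_mono) auto
    moreover have "(2::real) ^ (3 * p) = 2 ^ (3 * p - 1) * 2"
      using p by (simp flip: power_Suc2)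
    then have "c = 1 / 2 ^ (3 * p - 1) * (fact (p - 1) / (2 * N))"
      by (simp add: c_def)
    ultimately show "c * (A t + a) powr (q - 1) \<le> a powr q"
      unfolding tr(2) by (intro mult_right_mono) auto
  qed (use q_ge_2 tr(1) A_nonneg[of t] t N(1) in \<open>auto simp: c_def\<close>)
  moreover have "real t * (c powr (1 / q) / q) \<le> A t powr (1 / q)"
    using Suc by (simp add: c_def)
  moreover have "real (Suc t) * d = real t * d + d" for d
    by (simp add: distrib_right)
  then have "real (Suc t) * (c powr (1 / q) / q) = real t * (c powr (1 / q) / q) + c powr (1 / q) / q" .
  ultimately show ?case
    unfolding update(3)[OF t] a_def c_def by linarith
qed simp

text \<open>Squeezing the minimum of \<psi>_t between both estimates bounds A_t (f(x_t) - f z)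
  independently of t; the growth of A_t does the rest.\<close>

lemma rate:
  assumes N: "N > 0" "\<And>t. t \<le> Suc T \<Longrightarrow> H t \<le> N" and t: "1 \<le> t" "t \<le> Suc T"
  shows "f (x t) - f z \<le> 2 ^ (3 * p) * N * q powr (q - 1) * pn (x0 - z) powr q / (fact (p - 1) * real t powr q)"
proof -
  define c where "c = fact (p - 1) / (2 ^ (3 * p) * N)"
  have c: "c > 0" using N by (simp add: c_def)
  have q: "q > 0" using q_ge_2 by simp
  have "(real t * (c powr (1 / q) / q)) powr q \<le> (A t powr (1 / q)) powr q"
    using A_growth[OF N t(2)] q by (intro powr_mono2) (auto simp: c_def)
  then have A: "real t powr q * c / q powr q \<le> A t"
    using c q A_nonneg[OF t(2)] by (simp add: powr_mult powr_divide powr_powr)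
  then have Apos: "A t > 0"
    using c q t by (auto intro: less_le_trans[rotated])
  have "A t * (f (x t) - f z) \<le> pn (x0 - z) powr q / q"
    using estimate_lower[OF t(2)] v_minimises[OF t(2), of z] estimate_upper[OF t(2), of z]
    by (simp add: pn_minus_commute[of x0 z] right_diff_distrib)
  then have "f (x t) - f z \<le> (pn (x0 - z) powr q / q) / A t"
    by (simp only: pos_le_divide_eq[OF Apos] mult.commute[of _ "A t"])
  also have "\<dots> \<le> (pn (x0 - z) powr q / q) / (real t powr q * c / q powr q)"
    using A Apos c q t by (intro divide_left_mono) auto
  also have "\<dots> = 2 ^ (3 * p) * N * q powr (q - 1) * pn (x0 - z) powr q / (fact (p - 1) * real t powr q)"
    using q N by (simp add: c_def powr_diff mult_ac)
  finally show ?thesis .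
qed

end

section \<open>Complexity bounds\<close>

lemma le_one_plus_root:
  fixes C \<epsilon> q :: real
  assumes q: "q > 0" and \<epsilon>: "\<epsilon> > 0" and C: "C \<ge> 0" and T: "2 \<le> T \<Longrightarrow> \<epsilon> \<le> C / (real T - 1) powr q"
  shows "real T \<le> 1 + C powr (1 / q) * (1 / \<epsilon>) powr (1 / q)"
proof (cases "2 \<le> T")
  case True
  then have pos: "real T - 1 > 0" by simp
  then have "(real T - 1) powr q \<le> C * (1 / \<epsilon>)"
    using T[OF True] \<epsilon> by (simp add: field_simps)
  then have "((real T - 1) powr q) powr (1 / q) \<le> (C * (1 / \<epsilon>)) powr (1 / q)"
    using q by (intro powr_mono2) auto
  then show ?thesis using q pos C \<epsilon> by (simp add: powr_powr powr_mult powr_divide)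
next
  case False
  then have "real T \<le> 1" by simp
  moreover have "0 \<le> C powr (1 / q) * (1 / \<epsilon>) powr (1 / q)" by simp
  ultimately show ?thesis by linarith
qed

theorem theorem4p5:
  fixes B :: "'a::euclidean_space \<Rightarrow> ('a \<Rightarrow>\<^sub>L real)"
    and f :: "'a \<Rightarrow> real"
    and p T :: nat
    and \<nu> \<alpha> \<theta> H0 D0 \<epsilon> :: real
    and known :: bool
    and x0 xs :: 'a
    and x v :: "nat \<Rightarrow> 'a"
    and A H :: "nat \<Rightarrow> real"
    and \<psi> :: "nat \<Rightarrow> 'a \<Rightarrow> real"
    and it :: "nat \<Rightarrow> nat"
    and aa g :: "nat \<Rightarrow> nat \<Rightarrow> real"
    and y xp :: "nat \<Rightarrow> nat \<Rightarrow> 'a"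
  assumes "self_adjoint_pos_def B"
    and "p \<ge> 2"
    and "convex_on UNIV f"
    and "times_differentiable p f"
    and "\<forall>z. f xs \<le> f z"
    and "0 \<le> \<nu>" and "\<nu> \<le> 1"
    and "holder_const B f p \<nu> < \<infinity>"
    and "D0 > 1"
    and "\<forall>z\<in>{z. f z \<le> f x0}. primal_norm B (z - xs) \<le> D0"
    and "\<alpha> = (if known then \<nu> else 1)"
    and "0 < \<epsilon>" and "\<epsilon> < 1"
    and "H0 > 0" and "\<theta> \<ge> 0"
    and "AATM_run B f p \<alpha> \<theta> x0 H0 T x v A H \<psi> it aa g y xp"
    and "f x0 - f xs \<ge> \<epsilon>"
    and "\<forall>t\<le>T. \<forall>i\<le>it t. f (xp t i) - f xs \<ge> \<epsilon>"
  shows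
    "(\<forall>t. 2 \<le> t \<and> t \<le> T \<longrightarrow>
        f (x t) - f xs
          \<le> (2 ^ (3 * p) * max (N_tilde B f p \<theta> xs known \<nu> \<epsilon>) H0
                * (real p + \<alpha>) powr (real p + \<alpha> - 1)
                * primal_norm B (x0 - xs) powr (real p + \<alpha>))
             / (fact (p - 1) * (real t - 1) powr (real p + \<alpha>)))
     \<and> (known \<longrightarrow>
        real T \<le> 1 +
          ((2 ^ (3 * p)
              * max H0 ((real p + \<nu> - 1)
                        * (real_of_ereal (holder_const B f p \<nu>) + \<theta> * fact (p - 1)))
              * (real p + \<nu>) powr (real p + \<nu> - 1)
              * primal_norm B (x0 - xs) powr (real p + \<nu>))
             / fact (p - 1)) powr (1 / (real p + \<nu>))
          * (1 / \<epsilon>) powr (1 / (real p + \<nu>)))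
     \<and> (\<not> known \<longrightarrow>
        real T \<le> 1 +
          ((2 ^ (3 * p)
              * max H0 (max (4 * \<theta> * fact (p - 1))
                          ((4 * real_of_ereal (holder_const B f p \<nu>))
                              powr (real p / (real p + \<nu> - 1))
                            * (4 * D0) powr ((1 - \<nu>) / (real p + \<nu> - 1))))
              * (real p + 1) ^ p
              * primal_norm B (x0 - xs) ^ (p + 1))
             / fact (p - 1)) powr (1 / (real p + 1))
          * (1 / \<epsilon>) powr (real p / ((real p + 1) * (real p + \<nu> - 1))))"
proof -
  have \<alpha>: "0 \<le> \<alpha>" "\<alpha> \<le> 1" using assms(6,7,11) by auto
  have diff: "f differentiable (at z)" for z
    using assms(2,4) by (auto simp: times_differentiable_def dest: spec[of _ "[]"])
  interpret aatm B f p T \<alpha> \<theta> H0 x0 x v A H \<psi> it aa g y xp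
    by unfold_locales (use assms \<alpha> diff in auto)
  note f = assms(4) and fin = assms(8)
  define Hf where "Hf = real_of_ereal (holder_const B f p \<nu>)"
  define R where "R = level_radius B f xs \<epsilon>"
  define N where "N = max (N_tilde B f p \<theta> xs known \<nu> \<epsilon>) H0"
  define K where "K = q powr (q - 1) * pn (x0 - xs) powr q"
  have N: "N > 0" using assms(14) by (simp add: N_def)
  have level: "f xs + \<epsilon> \<le> f x0" using assms(17) by simp
  have R_le: "R \<le> D0"
    unfolding R_def using assms(10,12) level by (intro level_radius_le) auto
  have grad: "\<epsilon> \<le> dn (gradient f (xp t i)) * R" if "t \<le> T" "i \<le> it t" for t i
    unfolding R_def using assms(18) that
    by (intro le_gradient_level_radius[OF assms(3) diff assms(5) level assms(12) _ assms(10)]) auto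
  \<comment> \<open>Iteration 0 always has the trial i = 0, and its gradient bound excludes R <=
    0.\<close>
  have R: "R > 0"
  proof -
    have "0 < dn (gradient f (xp 0 0)) * R" using grad[of 0 0] assms(12) by simp
    then show ?thesis using dn_nonneg[of "gradient f (xp 0 0)"] by (simp add: zero_less_mult_iff)
  qed
  have "accepted B f p \<alpha> (2 ^ i * H t) (y t i) (xp t i)"
    if t: "t \<le> T" "i \<le> it t" and ge: "N_tilde B f p \<theta> xs known \<nu> \<epsilon> \<le> 2 ^ i * H t" for t i
  proof (cases known)
    case True
    then show ?thesis
      using accepted_known[OF f assms(2,6,7) fin, of "2 ^ i * H t" \<theta> "y t i" "xp t i"]
        trial(5)[OF t] H_pos[of t] t ge assms(11) by (simp add: N_tilde_def)
  next
    case False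
    then show ?thesis
      using accepted_unknown[OF f assms(2,6,7) fin _ assms(15) _ assms(12) _ grad[OF t], of "2 ^ i * H t" "y t i"]
        trial(5)[OF t] H_pos[of t] t ge assms(11) R by (simp add: N_tilde_def Let_def R_def)
  qed
  then have H_le: "H t \<le> N" if "t \<le> Suc T" for t
    unfolding N_def using that by (rule regularisation_le)
  have bound: "f (x t) - f xs \<le> 2 ^ (3 * p) * N * K / (fact (p - 1) * (real t - 1) powr q)"
    if t: "2 \<le> t" "t \<le> T" for t
  proof -
    have "f (x t) - f xs \<le> 2 ^ (3 * p) * N * K / (fact (p - 1) * real t powr q)"
      using rate[OF N H_le, of t xs] t by (simp add: K_def mult.assoc)
    \<comment> \<open>\<open>rate\<close> has t in the denominator; it is weakened to the stated t -
      1.\<close>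
    also have "\<dots> \<le> 2 ^ (3 * p) * N * K / (fact (p - 1) * (real t - 1) powr q)"
      using t N q_ge_2
      by (intro divide_left_mono mult_left_mono powr_mono2 mult_nonneg_nonneg mult_pos_pos) (auto simp: K_def)
    finally show ?thesis .
  qed
  have final: "real T \<le> 1 + (2 ^ (3 * p) * N * K / fact (p - 1)) powr (1 / q) * (1 / \<epsilon>) powr (1 / q)"
  proof (rule le_one_plus_root)
    assume T: "2 \<le> T"
    \<comment> \<open>x_T is the accepted trial point of iteration T - 1, so its gap is still at
      least \<epsilon>.\<close>
    then obtain T' where T': "T = Suc T'" by (cases T) auto
    then have "\<epsilon> \<le> f (x T) - f xs"
      using assms(18) update(2)[of T'] by simp
    also have "\<dots> \<le> 2 ^ (3 * p) * N * K / (fact (p - 1) * (real T - 1) powr q)"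
      by (rule bound[OF T order_refl])
    finally show "\<epsilon> \<le> 2 ^ (3 * p) * N * K / fact (p - 1) / (real T - 1) powr q"
      by simp
  qed (use N q_ge_2 assms(12) in \<open>auto simp: K_def\<close>)
  show ?thesis
  proof (intro conjI impI allI)
    fix t assume "2 \<le> t \<and> t \<le> T"
    then show "f (x t) - f xs \<le> (2 ^ (3 * p) * max (N_tilde B f p \<theta> xs known \<nu> \<epsilon>) H0
          * (real p + \<alpha>) powr (real p + \<alpha> - 1) * primal_norm B (x0 - xs) powr (real p + \<alpha>))
        / (fact (p - 1) * (real t - 1) powr (real p + \<alpha>))"
      using bound[of t] by (simp add: K_def N_def mult.assoc)
  next
    assume known
    then show "real T \<le> 1 +
          ((2 ^ (3 * p)
              * max H0 ((real p + \<nu> - 1)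
                        * (real_of_ereal (holder_const B f p \<nu>) + \<theta> * fact (p - 1)))
              * (real p + \<nu>) powr (real p + \<nu> - 1)
              * primal_norm B (x0 - xs) powr (real p + \<nu>))
             / fact (p - 1)) powr (1 / (real p + \<nu>))
          * (1 / \<epsilon>) powr (1 / (real p + \<nu>))"
      using final assms(11) by (simp add: K_def N_def N_tilde_def max.commute mult.assoc)
  next
    assume unknown: "\<not> known"
    then have \<alpha>1: "\<alpha> = 1" using assms(11) by simp
    define P where "P = real p + \<nu> - 1"
    define e where "e = (1 - \<nu>) / P"
    \<comment> \<open>\<open>N'\<close> is free of \<epsilon>: as \<epsilon> < 1 and e >= 0, the
      factor (1/\<epsilon>)^e is at least 1 and can be pulled out of the whole maximum.\<close>
    define N' where "N' = max H0 (max (4 * \<theta> * fact (p - 1)) ((4 * Hf) powr (real p / P) * (4 * D0) powr e))"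
    have P: "P \<ge> 1" using assms(2,6) by (simp add: P_def)
    have e: "e \<ge> 0" using P assms(7) by (simp add: e_def)
    have inv: "1 \<le> (1 / \<epsilon>) powr e"
      using assms(12,13) e by (intro ge_one_powr_ge_zero) auto
    have N': "N' > 0" using assms(14) by (simp add: N'_def)
    have scale: "w \<le> N' * (1 / \<epsilon>) powr e" if "w \<le> N'" for w
    proof -
      have "N' * 1 \<le> N' * (1 / \<epsilon>) powr e" using N' inv by (intro mult_left_mono) auto
      then show ?thesis using that by simp
    qed
    have "(4 * R / \<epsilon>) powr e \<le> (4 * D0 / \<epsilon>) powr e"
      using R R_le assms(12) e by (intro powr_mono2 divide_right_mono) auto
    also have "\<dots> = (4 * D0) powr e * (1 / \<epsilon>) powr e"
      using assms(9,12) by (simp add: powr_divide)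
    finally have "(4 * Hf) powr (real p / P) * (4 * R / \<epsilon>) powr e
        \<le> (4 * Hf) powr (real p / P) * (4 * D0) powr e * (1 / \<epsilon>) powr e"
      by (simp add: mult_left_mono mult.assoc)
    also have "\<dots> \<le> N' * (1 / \<epsilon>) powr e"
      by (intro mult_right_mono) (auto simp: N'_def)
    finally have holder: "(4 * Hf) powr (real p / P) * (4 * R / \<epsilon>) powr e \<le> N' * (1 / \<epsilon>) powr e" .
    have "H0 \<le> N' * (1 / \<epsilon>) powr e" "4 * \<theta> * fact (p - 1) \<le> N' * (1 / \<epsilon>) powr e"
      by (intro scale; simp add: N'_def)+
    then have "N \<le> N' * (1 / \<epsilon>) powr e"
      using unknown holder
      by (simp add: N_def N_tilde_def Let_def flip: Hf_def R_def P_def e_def)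
    then have "2 ^ (3 * p) * N * K / fact (p - 1) \<le> 2 ^ (3 * p) * (N' * (1 / \<epsilon>) powr e) * K / fact (p - 1)"
      by (intro divide_right_mono mult_right_mono mult_left_mono) (auto simp: K_def)
    then have "(2 ^ (3 * p) * N * K / fact (p - 1)) powr (1 / q)
        \<le> (2 ^ (3 * p) * (N' * (1 / \<epsilon>) powr e) * K / fact (p - 1)) powr (1 / q)"
      using N q_ge_2 by (intro powr_mono2) (auto simp: K_def)
    also have "2 ^ (3 * p) * (N' * (1 / \<epsilon>) powr e) * K / fact (p - 1)
        = (2 ^ (3 * p) * N' * K / fact (p - 1)) * (1 / \<epsilon>) powr e"
      by simp
    also have "\<dots> powr (1 / q) = (2 ^ (3 * p) * N' * K / fact (p - 1)) powr (1 / q) * (1 / \<epsilon>) powr (e * (1 / q))"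
      using N' by (subst powr_mult) (auto simp: K_def powr_powr)
    finally have "(2 ^ (3 * p) * N * K / fact (p - 1)) powr (1 / q) * (1 / \<epsilon>) powr (1 / q)
        \<le> (2 ^ (3 * p) * N' * K / fact (p - 1)) powr (1 / q) * (1 / \<epsilon>) powr (e * (1 / q)) * (1 / \<epsilon>) powr (1 / q)"
      by (intro mult_right_mono) auto
    also have "\<dots> = (2 ^ (3 * p) * N' * K / fact (p - 1)) powr (1 / q) * (1 / \<epsilon>) powr (e * (1 / q) + 1 / q)"
      by (simp add: powr_add mult.assoc)
    \<comment> \<open>The powers of 1/\<epsilon> from \<open>N\<close> and from the rate combine
      because e + 1 = p / P.\<close>
    also have "e * (1 / q) + 1 / q = real p / ((real p + 1) * P)"
    proof -
      have "e + 1 = real p / P" using P by (simp add: e_def P_def field_simps)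
      moreover have "e * (1 / q) + 1 / q = (e + 1) * (1 / q)"
        by (simp only: distrib_right mult_1_left)
      ultimately show ?thesis by (simp add: \<alpha>1 mult.commute)
    qed
    finally have "real T \<le> 1 + (2 ^ (3 * p) * N' * K / fact (p - 1)) powr (1 / q)
        * (1 / \<epsilon>) powr (real p / ((real p + 1) * P))"
      using final by linarith
    moreover have "K = (real p + 1) ^ p * pn (x0 - xs) ^ (p + 1)"
    proof -
      have "pn (x0 - xs) powr real (p + 1) = pn (x0 - xs) ^ (p + 1)"
        using pn_nonneg[of "x0 - xs"] by (intro powr_realpow') auto
      moreover have "(real p + 1) powr real p = (real p + 1) ^ p"
        by (intro powr_realpow) simp
      ultimately show ?thesis by (simp add: K_def \<alpha>1 add.commute)
    qed
    ultimately show "real T \<le> 1 +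
          ((2 ^ (3 * p)
              * max H0 (max (4 * \<theta> * fact (p - 1))
                          ((4 * real_of_ereal (holder_const B f p \<nu>))
                              powr (real p / (real p + \<nu> - 1))
                            * (4 * D0) powr ((1 - \<nu>) / (real p + \<nu> - 1))))
              * (real p + 1) ^ p
              * primal_norm B (x0 - xs) ^ (p + 1))
             / fact (p - 1)) powr (1 / (real p + 1))
          * (1 / \<epsilon>) powr (real p / ((real p + 1) * (real p + \<nu> - 1)))"
      by (simp only: N'_def Hf_def P_def e_def \<alpha>1 mult.assoc)
  qed
qed

end
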